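(* (Soundness of $\delta$.) Let $\Gamma;\dot\Sigma\vdash e:(\tau;\sigma)$ be a Linear A judgment and $\theta$ an enumeration of the tangent variables in $\dot\Sigma$. For every assignment $\rho$ of vectors to the primal variables of $\Gamma$ there is a $\lambda LL$ term $F$ such that $$\delta_\theta(e)\{\rho(x)^{\mathsf p}/x\}_{x\in\Gamma}\;\rightarrow^*\;\big(\,!\,([\![e]\!]^{\mathsf p}_{\rho})^{\mathsf p},\;\S F\,\big),$$ and, for every assignment $s$ of vectors to the tangent variables $\theta=(\dot y_1,\dots,\dot y_m)$, $$F\,\langle s(\dot y_1)^{\mathsf t},\dots,s(\dot y_m)^{\mathsf t}\rangle\;\rightarrow^*\;([\![e]\!]^{\mathsf t}_{\rho;s})^{\mathsf t}.$$
   Context: **Calculus $\lambda LL$.** Fix function symbols $\underline f$ with arities $n\ge 1$, each denoting a differentiable $f:\mathbb R^n\to\mathbb R$. Types: $A,B::=\mathbb R\mid A\multimap B\mid 1\mid A\otimes B\mid\top\mid A\& B\mid {!A}$. Each variable has a fixed type. Patterns: $p,q::=x\mid {!x}\mid ()\mid (p,q)\mid\langle p,q\rangle$, no variable repeated, typed by $x:A$, $!x:{!A}$ (for $x$ of type $A$), $():1$, $(p,q):A\otimes B$, $\langle p,q\rangle:A\& B$. An environment is a finite set of typed patterns with disjoint variables; $!\Gamma$ means all patterns are of the form $!x$; the comma is variable-disjoint union. Terms: $M,N::=x\mid {!M}\mid\lambda p.M\mid MN\mid ()\mid (M,N)\mid\langle\rangle\mid\langle M,N\rangle\mid\underline r\mid\underline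 f\mid\dot+\mid\dot*$ ($r\in\mathbb R$). Typing: $x:A\vdash x:A$; $!x:{!A}\vdash x:A$; $!\Gamma\vdash M:A\Rightarrow{!\Gamma}\vdash{!M}:{!A}$; $\Delta\vdash M:B\Rightarrow{!x}:{!A},\Delta\vdash M:B$; $p:A,\Delta\vdash M:B\Rightarrow\Delta\vdash\lambda p.M:A\multimap B$; if $!\Gamma_i,\Delta_i\vdash M_i:A_i$ ($i=1,2$) then $!\Gamma_1\cup{!\Gamma_2},\Delta_1,\Delta_2\vdash M_1M_2:B$ when $A_1=A_2\multimap B$, and $\vdash(M_1,M_2):A_1\otimes A_2$ in that same environment; $\vdash():1$; $\Delta\vdash M:B\Rightarrow():1,\Delta\vdash M:B$; $p:A,q:B,\Delta\vdash M:C\Rightarrow(p,q):A\otimes B,\Delta\vdash M:C$; $\Delta\vdash M_1:A_1$ and $\Delta\vdash M_2:A_2\Rightarrow\Delta\vdash\langle M_1,M_2\rangle:A_1\& A_2$; $p_i:A_i,\Delta\vdash M:B\Rightarrow\langle p_1,p_2\rangle:A_1\& A_2,\Delta\vdash M:B$ ($i=1$ or $2$); $\Delta\vdash\langle\rangle:\top$; $\vdash\underline r:\mathbb R$; $\Delta\vdash\underline0:\mathbb R$; $\vdash\underline f:({!\mathbb R}\otimes\dots\otimes{!\mathbb R})\multimap{!\mathbb R}$; $\vdash\dot+:\mathbb R\&\mathbb R\multimap\mathbb R$; $\vdash\dot*:\mathbb R\multimap\mathbb R\multimap\mathbb R$. Reduction $\rightarrow$ is the closure under all term contexts of: $(\lambda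 p.M)V\to M\{V/p\}$ for $V$ a value for $p$; $\underline f(!\underline{r_1},\dots,!\underline{r_n})\to{!\underline{f(r_1,\dots,r_n)}}$; $\dot+\langle\underline r,\underline s\rangle\to\underline{r+s}$; $\dot*\,\underline r\,\underline s\to\underline{rs}$. A value for $x$ is any term, for $!x$ any $!M$, for $()$ is $()$, for $(p_1,p_2)$ (resp. $\langle p_1,p_2\rangle$) a pair $(V_1,V_2)$ (resp. $\langle V_1,V_2\rangle$) of values for $p_1,p_2$; substitution acts componentwise, with $M\{!N/!x\}=M\{N/x\}$ and $M\{()/()\}=M$. $\rightarrow^*$ is the reflexive-transitive closure. **Abbreviations.** $\mathtt{let}\ p=N\ \mathtt{in}\ M:=(\lambda p.M)N$; $\S A:=1\& A$ and $\S M:=\langle(),M\rangle$ for terms and patterns $M$. $n$-ary tuples $\langle M_1,\dots,M_n\rangle$ (and $A_1\&\dots\& A_n$, and tuple patterns) are right-nested; the $1$-ary tuple is its component; the empty tuple is $\langle\rangle$, the empty $\&$ is $\top$, and the empty tuple pattern is a fresh variable of type $\top$. For types $H$ built from $\mathbb R,\top,\&$: $\underline0_{\mathbb R}=\underline0$, $\underline0_\top=\langle\rangle$, $\underline0_{H\& H'}=\langle\underline0_H,\underline0_{H'}\rangle$; $\dot+_{\mathbb R}=\dot+$, $\dot+_\top=\lambda\langle h,h'\rangle.\langle\rangle$, $\dot+_{H\& K}=\lambda\langle\langle h,k\rangle,\langle h',k'\rangle\rangle.\langle\dot+_H\langle h,h'\rangle,\dot+_K\langle k,k'\rangle\rangle$;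 for a variable $x:\mathbb R$: $\dot*_{\mathbb R}x=\dot*x$, $\dot*_\top x=\lambda h.\langle\rangle$, $\dot*_{H\& K}x=\lambda\langle h,k\rangle.\langle(\dot*_Hx)h,(\dot*_Kx)k\rangle$. **Linear A.** Types $\tau,\sigma::=\mathbb R\mid1\mid\tau\otimes\sigma$. There are primal variables $x,z,\dots$ and tangent variables $\dot x,\dot y,\dots$, with fixed types. Judgments $\Gamma;\dot\Gamma\vdash e:(\tau;\sigma)$ ($\Gamma$ primal context, $\dot\Gamma$ tangent context; comma = disjoint union, $\cup$ = union): - $x:\tau;\dot y:\sigma\vdash(x;\dot y):(\tau;\sigma)$; - $\Gamma_1;\dot\Gamma_1\vdash e_1:(\tau_1;\sigma_1)$ and $\Gamma_2,x:\tau_1;\dot\Gamma_2,\dot y:\sigma_1\vdash e_2:(\tau;\sigma)$ give $\Gamma_1\cup\Gamma_2;\dot\Gamma_1,\dot\Gamma_2\vdash\mathtt{let}\,(x;\dot y)=e_1\,\mathtt{in}\,e_2:(\tau;\sigma)$; - $;\vdash\otimes():(1;1)$; $;\vdash\dot\otimes():(1;1)$; - $\Gamma;\dot\Gamma\vdash e:(\tau;\sigma)$ gives $\Gamma,z:1;\dot\Gamma\vdash\mathtt{let}\otimes()=z\,\mathtt{in}\,e:(\tau;\sigma)$ and $\Gamma;\dot\Gamma,\dot z:1\vdash\mathtt{let}\,\dot\otimes()=\dot z\,\mathtt{in}\,e:(\tau;\sigma)$; - $;\dot x_1:\tau_1,\dot x_2:\tau_2\vdash\dot\otimes(\dot x_1,\dot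 x_2):(1;\tau_1\otimes\tau_2)$; $\Gamma;\dot\Gamma,\dot x_1:\tau_1,\dot x_2:\tau_2\vdash e:(\tau;\sigma)$ gives $\Gamma;\dot\Gamma,\dot z:\tau_1\otimes\tau_2\vdash\mathtt{let}\,\dot\otimes(\dot x_1,\dot x_2)=\dot z\,\mathtt{in}\,e:(\tau;\sigma)$; - $;\vdash\dot0_\tau:(1;\tau)$; $;\dot x:\tau,\dot y:\tau\vdash\dot x\,\dot+\,\dot y:(1;\tau)$; $x:\mathbb R;\dot y:\tau\vdash x\,\dot*\,\dot y:(1;\tau)$; $;\vdash\underline r:(\mathbb R;1)$; $x_1:\mathbb R,\dots,x_n:\mathbb R;\vdash\underline f(x_1,\dots,x_n):(\mathbb R;1)$; $;\dot x:\tau\vdash\mathrm{dup}(\dot x):(1;\tau\otimes\tau)$; $\Gamma;\dot\Gamma\vdash e:(\tau;\sigma)$ gives $\Gamma;\dot\Gamma\vdash\mathrm{drop}(e):(1;1)$. $FV^t(e)$ is the set of free tangent variables of $e$. **Semantics.** Vectors: $V(\mathbb R)=\mathbb R$, $V(1)=\{\star\}$, $V(\tau\otimes\sigma)=V(\tau)\times V(\sigma)$, with componentwise sum, zero and scalar multiplication. Given an assignment $\rho$ of vectors (of the right types) to the free primal variables and $s$ to the free tangent variables, $[\![e]\!]^{\mathsf p}_\rho\in V(\tau)$ and $[\![e]\!]^{\mathsf t}_{\rho;s}\in V(\sigma)$ are given (as pairs primal/tangent, restricting assignments to free variables as needed) by: $(x;\dot y)\mapsto(\rho(x),s(\dot y))$;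 $\mathtt{let}\,(x;\dot y)=e_1\,\mathtt{in}\,e_2$: the pair of $e_2$ under $\rho[x\mapsto[\![e_1]\!]^{\mathsf p}_\rho]$, $s[\dot y\mapsto[\![e_1]\!]^{\mathsf t}_{\rho;s}]$; $\otimes(),\dot\otimes()\mapsto(\star,\star)$; $\mathtt{let}\otimes()=z\,\mathtt{in}\,e$ and $\mathtt{let}\,\dot\otimes()=\dot z\,\mathtt{in}\,e$: as $e$; $\dot\otimes(\dot x_1,\dot x_2)\mapsto(\star,(s(\dot x_1),s(\dot x_2)))$; $\mathtt{let}\,\dot\otimes(\dot x_1,\dot x_2)=\dot z\,\mathtt{in}\,e$: as $e$ with $(s(\dot x_1),s(\dot x_2)):=s(\dot z)$; $\dot0_\tau\mapsto(\star,0)$; $\dot x\dot+\dot y\mapsto(\star,s(\dot x)+s(\dot y))$; $x\dot*\dot y\mapsto(\star,\rho(x)\cdot s(\dot y))$; $\underline r\mapsto(r,\star)$; $\underline f(x_1,\dots,x_n)\mapsto(f(\rho(x_1),\dots,\rho(x_n)),\star)$; $\mathrm{dup}(\dot x)\mapsto(\star,(s(\dot x),s(\dot x)))$; $\mathrm{drop}(e)\mapsto(\star,\star)$. **Translation of types and vectors.** $\mathsf p(\mathbb R)=\mathbb R$, $\mathsf p(1)=1$, $\mathsf p(\tau\otimes\sigma)={!\mathsf p(\tau)}\otimes{!\mathsf p(\sigma)}$; $\mathsf t(\mathbb R)=\mathbb R$, $\mathsf t(1)=\top$, $\mathsf t(\tau\otimes\sigma)=\mathsf t(\tau)\&\mathsf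 t(\sigma)$. A vector $a\in V(\tau)$ has encodings $a^{\mathsf p}:\mathsf p(\tau)$ and $a^{\mathsf t}:\mathsf t(\tau)$: $r^{\mathsf p}=r^{\mathsf t}=\underline r$, $\star^{\mathsf p}=()$, $\star^{\mathsf t}=\langle\rangle$, $(a,b)^{\mathsf p}=(!a^{\mathsf p},!b^{\mathsf p})$, $(a,b)^{\mathsf t}=\langle a^{\mathsf t},b^{\mathsf t}\rangle$. **Translation $\delta$.** For $\Gamma;\dot\Gamma\vdash e:(\tau;\sigma)$ and an enumeration $\theta$ of $\dot\Gamma=FV^t(e)$, $\delta_\theta(e)$ has type ${!\mathsf p(\tau)}\otimes\S((\&_{\dot y:\sigma'\in\theta}\mathsf t(\sigma'))\multimap\mathsf t(\sigma))$ in the environment $\{!x:{!\mathsf p(\tau')}\mid x:\tau'\in\Gamma\}$ (primal variables are used as $\lambda LL$ variables of type $\mathsf p(\tau')$). Write $u_\theta=\langle u_{\dot y}\rangle_{\dot y\in\theta}$ for a tuple (pattern) of fresh variables $u_{\dot y}:\mathsf t(\sigma')$, for $\dot y:\sigma'$ in $\theta$, and $\theta\cap X$, $\theta\setminus\dot z$ for the corresponding sublists. - $\delta_\theta((x;\dot y))=(!x,\S(\lambda u_\theta.u_{\dot y}))$; - $\delta_\theta(\mathtt{let}\,(x;\dot y)=e_1\,\mathtt{in}\,e_2)=\mathtt{let}\,(!x,\S f)=\delta_{\theta_1}(e_1)\,\mathtt{in}\,\mathtt{let}\,(!z,\S g)=\delta_{\dot y,\theta_2}(e_2)\,\mathtt{in}\,(!z,\S(\lambda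 u_\theta.\,g\langle f\,u_{\theta_1},u_{\dot w}\rangle_{\dot w\in\theta_2}))$, where $\theta_i=\theta\cap FV^t(e_i)$ and the argument of $g$ is the tuple with first component $f\,u_{\theta_1}$ followed by $u_{\dot w}$, $\dot w\in\theta_2$; - $\delta_\theta(\otimes())=\delta_\theta(\dot\otimes())=(!(),\S(\lambda y^\top.\langle\rangle))$; $\delta_\theta(\mathtt{let}\otimes()=z\,\mathtt{in}\,e)=\mathtt{let}\,()=z\,\mathtt{in}\,\delta_\theta(e)$; - $\delta_\theta(\mathtt{let}\,\dot\otimes()=\dot z\,\mathtt{in}\,e)=\mathtt{let}\,(!x,\S f)=\delta_{\theta\setminus\dot z}(e)\,\mathtt{in}\,(!x,\S(\lambda u_\theta.f\,u_{\theta\setminus\dot z}))$; - $\delta_\theta(\dot\otimes(\dot x_1,\dot x_2))=(!(),\S(\lambda u_\theta.\langle u_{\dot x_1},u_{\dot x_2}\rangle))$; - $\delta_\theta(\mathtt{let}\,\dot\otimes(\dot x_1,\dot x_2)=\dot z\,\mathtt{in}\,e)=\mathtt{let}\,(!x,\S f)=\delta_{\dot x_1,\dot x_2,\theta\setminus\dot z}(e)\,\mathtt{in}\,(!x,\S(\lambda u_\theta[\langle x_1,x_2\rangle/u_{\dot z}].\,f\langle x_1,x_2,u_{\dot w}\rangle_{\dot w\in\theta\setminus\dot z}))$, where $u_\theta[\langle x_1,x_2\rangle/u_{\dot z}]$ is the pattern $u_\theta$ with $u_{\dot z}$ replaced by $\langle x_1,x_2\rangle$; - $\delta_\theta(\underline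 r)=(!\underline r,\S(\lambda y^\top.\langle\rangle))$; $\delta_\theta(\underline f(x_1,\dots,x_n))=(\underline f(!x_1,\dots,!x_n),\S(\lambda y^\top.\langle\rangle))$; $\delta_\theta(\dot0_\sigma)=(!(),\S(\lambda y^\top.\underline0_{\mathsf t(\sigma)}))$; - for $\dot y_1,\dot y_2,\dot y:\tau$: $\delta_\theta(\dot y_1\dot+\dot y_2)=(!(),\S(\lambda u_\theta.\dot+_{\mathsf t(\tau)}\langle u_{\dot y_1},u_{\dot y_2}\rangle))$; $\delta_\theta(x\dot*\dot y)=(!(),\S(\lambda u_\theta.(\dot*_{\mathsf t(\tau)}x)u_{\dot y}))$; $\delta_\theta(\mathrm{dup}(\dot y))=(!(),\S(\lambda u_\theta.\langle u_{\dot y},u_{\dot y}\rangle))$; - $\delta_\theta(\mathrm{drop}(e))=\mathtt{let}\,(!x,\S f)=\delta_\theta(e)\,\mathtt{in}\,(!(),\S(\lambda y.\mathtt{let}\ z=f\,y\ \mathtt{in}\,\langle\rangle))$. *)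

theory Defs
  imports "HOL-Analysis.L2_Norm"
begin

section \<open>Function symbols\<close>

text \<open>
  Function symbols are the elements of an arbitrary type; symbol \<open>f\<close> has arity \<open>ar f\<close> and denotes
  \<open>den f\<close>. Since the arity varies with the symbol, a point of \<open>R^n\<close> is a list of length \<open>n\<close>.
  The next definition is Frechet differentiability on all of \<open>R^n\<close>, with gradient \<open>c\<close> at \<open>xs\<close>.
\<close>

definition differentiable_Rn :: "nat \<Rightarrow> (real list \<Rightarrow> real) \<Rightarrow> bool" where
  "differentiable_Rn n f \<longleftrightarrow>
     (\<forall>xs. length xs = n \<longrightarrow>
       (\<exists>c :: nat \<Rightarrow> real. \<forall>\<epsilon>>0. \<exists>\<delta>>0. \<forall>ys. length ys = n \<longrightarrow>
          L2_set (\<lambda>i. ys ! i - xs ! i) {..<n} < \<delta> \<longrightarrow>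
          \<bar>f ys - f xs - (\<Sum>i<n. c i * (ys ! i - xs ! i))\<bar>
            \<le> \<epsilon> * L2_set (\<lambda>i. ys ! i - xs ! i) {..<n}))"


section \<open>Linear A\<close>

datatype lty = LReal | LOne | LTensor lty lty

text \<open>Every variable carries its type, so that a typing context is just a set of variables.\<close>

datatype primvar = PVar nat (pty: lty)
datatype tanvar = TVar nat (tty: lty)

datatype 'f exp =
    EVar primvar tanvar                       \<comment> \<open>\<open>(x; y)\<close>\<close>
  | ELet primvar tanvar "'f exp" "'f exp"     \<comment> \<open>\<open>let (x; y) = e1 in e2\<close>\<close>
  | EPUnit                               \<comment> \<open>primal unit\<close>
  | ETUnit                               \<comment> \<open>tangent unit\<close>
  | ELetPUnit primvar "'f exp"
  | ELetTUnit tanvar "'f exp"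
  | ETPair tanvar tanvar
  | ELetTPair tanvar tanvar tanvar "'f exp"    \<comment> \<open>\<open>ELetTPair x1 x2 z e\<close> is \<open>let (x1, x2) = z in e\<close>\<close>
  | EZero lty
  | EAdd tanvar tanvar
  | EScale primvar tanvar
  | EConst real
  | EFun 'f "primvar list"
  | EDup tanvar
  | EDrop "'f exp"

inductive ltyping :: "('f \<Rightarrow> nat) \<Rightarrow> primvar set \<Rightarrow> tanvar set \<Rightarrow> 'f exp \<Rightarrow> lty \<Rightarrow> lty \<Rightarrow> bool"
  for ar :: "'f \<Rightarrow> nat" where
  ty_Var: "ltyping ar {x} {y} (EVar x y) (pty x) (tty y)"
| ty_Let: "\<lbrakk>ltyping ar \<Gamma>1 \<Delta>1 e1 (pty x) (tty y);
     ltyping ar (insert x \<Gamma>2) (insert y \<Delta>2) e2 \<tau> \<sigma>;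
     x \<notin> \<Gamma>2; y \<notin> \<Delta>2; \<Delta>1 \<inter> \<Delta>2 = {}\<rbrakk>
     \<Longrightarrow> ltyping ar (\<Gamma>1 \<union> \<Gamma>2) (\<Delta>1 \<union> \<Delta>2) (ELet x y e1 e2) \<tau> \<sigma>"
| ty_PUnit: "ltyping ar {} {} EPUnit LOne LOne"
| ty_TUnit: "ltyping ar {} {} ETUnit LOne LOne"
| ty_LetPUnit: "\<lbrakk>ltyping ar \<Gamma> \<Delta> e \<tau> \<sigma>; pty z = LOne; z \<notin> \<Gamma>\<rbrakk>
     \<Longrightarrow> ltyping ar (insert z \<Gamma>) \<Delta> (ELetPUnit z e) \<tau> \<sigma>"
| ty_LetTUnit: "\<lbrakk>ltyping ar \<Gamma> \<Delta> e \<tau> \<sigma>; tty z = LOne; z \<notin> \<Delta>\<rbrakk>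
     \<Longrightarrow> ltyping ar \<Gamma> (insert z \<Delta>) (ELetTUnit z e) \<tau> \<sigma>"
| ty_TPair: "x1 \<noteq> x2
     \<Longrightarrow> ltyping ar {} {x1, x2} (ETPair x1 x2) LOne (LTensor (tty x1) (tty x2))"
| ty_LetTPair: "\<lbrakk>ltyping ar \<Gamma> (insert x1 (insert x2 \<Delta>)) e \<tau> \<sigma>;
     x1 \<noteq> x2; x1 \<notin> \<Delta>; x2 \<notin> \<Delta>; z \<notin> \<Delta>; tty z = LTensor (tty x1) (tty x2)\<rbrakk>
     \<Longrightarrow> ltyping ar \<Gamma> (insert z \<Delta>) (ELetTPair x1 x2 z e) \<tau> \<sigma>"
| ty_Zero: "ltyping ar {} {} (EZero \<tau>) LOne \<tau>"
| ty_Add: "\<lbrakk>x \<noteq> y; tty x = \<tau>; tty y = \<tau>\<rbrakk> \<Longrightarrow> ltyping ar {} {x, y} (EAdd x y) LOne \<tau>"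
| ty_Scale: "pty x = LReal \<Longrightarrow> ltyping ar {x} {y} (EScale x y) LOne (tty y)"
| ty_Const: "ltyping ar {} {} (EConst r) LReal LOne"
| ty_Fun: "\<lbrakk>length xs = ar f; distinct xs; \<forall>x\<in>set xs. pty x = LReal\<rbrakk>
     \<Longrightarrow> ltyping ar (set xs) {} (EFun f xs) LReal LOne"
| ty_Dup: "ltyping ar {} {x} (EDup x) LOne (LTensor (tty x) (tty x))"
| ty_Drop: "ltyping ar \<Gamma> \<Delta> e \<tau> \<sigma> \<Longrightarrow> ltyping ar \<Gamma> \<Delta> (EDrop e) LOne LOne"

primrec fvt :: "'f exp \<Rightarrow> tanvar set" where
  "fvt (EVar x y) = {y}"
| "fvt (ELet x y e1 e2) = fvt e1 \<union> (fvt e2 - {y})"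
| "fvt EPUnit = {}"
| "fvt ETUnit = {}"
| "fvt (ELetPUnit z e) = fvt e"
| "fvt (ELetTUnit z e) = insert z (fvt e)"
| "fvt (ETPair x1 x2) = {x1, x2}"
| "fvt (ELetTPair x1 x2 z e) = insert z (fvt e - {x1, x2})"
| "fvt (EZero \<tau>) = {}"
| "fvt (EAdd x y) = {x, y}"
| "fvt (EScale x y) = {y}"
| "fvt (EConst r) = {}"
| "fvt (EFun f xs) = {}"
| "fvt (EDup x) = {x}"
| "fvt (EDrop e) = fvt e"

text \<open>The pair of types of an expression, determined by the types of its variables.\<close>

primrec pty_exp :: "'f exp \<Rightarrow> lty" where
  "pty_exp (EVar x y) = pty x"
| "pty_exp (ELet x y e1 e2) = pty_exp e2"
| "pty_exp EPUnit = LOne"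
| "pty_exp ETUnit = LOne"
| "pty_exp (ELetPUnit z e) = pty_exp e"
| "pty_exp (ELetTUnit z e) = pty_exp e"
| "pty_exp (ETPair x1 x2) = LOne"
| "pty_exp (ELetTPair x1 x2 z e) = pty_exp e"
| "pty_exp (EZero \<tau>) = LOne"
| "pty_exp (EAdd x y) = LOne"
| "pty_exp (EScale x y) = LOne"
| "pty_exp (EConst r) = LReal"
| "pty_exp (EFun f xs) = LReal"
| "pty_exp (EDup x) = LOne"
| "pty_exp (EDrop e) = LOne"

primrec tty_exp :: "'f exp \<Rightarrow> lty" where
  "tty_exp (EVar x y) = tty y"
| "tty_exp (ELet x y e1 e2) = tty_exp e2"
| "tty_exp EPUnit = LOne"
| "tty_exp ETUnit = LOne"
| "tty_exp (ELetPUnit z e) = tty_exp e"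
| "tty_exp (ELetTUnit z e) = tty_exp e"
| "tty_exp (ETPair x1 x2) = LTensor (tty x1) (tty x2)"
| "tty_exp (ELetTPair x1 x2 z e) = tty_exp e"
| "tty_exp (EZero \<tau>) = \<tau>"
| "tty_exp (EAdd x y) = tty x"
| "tty_exp (EScale x y) = tty y"
| "tty_exp (EConst r) = LOne"
| "tty_exp (EFun f xs) = LOne"
| "tty_exp (EDup x) = LTensor (tty x) (tty x)"
| "tty_exp (EDrop e) = LOne"

lemma ltyping_types: "ltyping ar \<Gamma> \<Delta> e \<tau> \<sigma> \<Longrightarrow> pty_exp e = \<tau> \<and> tty_exp e = \<sigma>"
  by (induction rule: ltyping.induct) auto

lemma ltyping_fvt: "ltyping ar \<Gamma> \<Delta> e \<tau> \<sigma> \<Longrightarrow> fvt e = \<Delta>"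
  by (induction rule: ltyping.induct) auto


section \<open>Vectors and the semantics of Linear A\<close>

datatype vec = VReal real | VStar | VPair (vfst: vec) (vsnd: vec)

primrec vecs :: "lty \<Rightarrow> vec set" where
  "vecs LReal = range VReal"
| "vecs LOne = {VStar}"
| "vecs (LTensor \<tau> \<sigma>) = {VPair a b | a b. a \<in> vecs \<tau> \<and> b \<in> vecs \<sigma>}"

primrec vreal :: "vec \<Rightarrow> real" where
  "vreal (VReal r) = r"

primrec vzero :: "lty \<Rightarrow> vec" where
  "vzero LReal = VReal 0"
| "vzero LOne = VStar"
| "vzero (LTensor \<tau> \<sigma>) = VPair (vzero \<tau>) (vzero \<sigma>)"

text \<open>Only sums of two vectors of the same type matter.\<close>

fun vadd :: "vec \<Rightarrow> vec \<Rightarrow> vec" where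
  "vadd (VReal r) (VReal s) = VReal (r + s)"
| "vadd VStar VStar = VStar"
| "vadd (VPair a b) (VPair a' b') = VPair (vadd a a') (vadd b b')"

primrec vscale :: "real \<Rightarrow> vec \<Rightarrow> vec" where
  "vscale c (VReal r) = VReal (c * r)"
| "vscale c VStar = VStar"
| "vscale c (VPair a b) = VPair (vscale c a) (vscale c b)"

primrec semp :: "('f \<Rightarrow> real list \<Rightarrow> real) \<Rightarrow> 'f exp \<Rightarrow> (primvar \<Rightarrow> vec) \<Rightarrow> vec" where
  "semp den (EVar x y) \<rho> = \<rho> x"
| "semp den (ELet x y e1 e2) \<rho> = semp den e2 (\<rho>(x := semp den e1 \<rho>))"
| "semp den EPUnit \<rho> = VStar"
| "semp den ETUnit \<rho> = VStar"
| "semp den (ELetPUnit z e) \<rho> = semp den e \<rho>"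
| "semp den (ELetTUnit z e) \<rho> = semp den e \<rho>"
| "semp den (ETPair x1 x2) \<rho> = VStar"
| "semp den (ELetTPair x1 x2 z e) \<rho> = semp den e \<rho>"
| "semp den (EZero \<tau>) \<rho> = VStar"
| "semp den (EAdd x y) \<rho> = VStar"
| "semp den (EScale x y) \<rho> = VStar"
| "semp den (EConst r) \<rho> = VReal r"
| "semp den (EFun f xs) \<rho> = VReal (den f (map (\<lambda>x. vreal (\<rho> x)) xs))"
| "semp den (EDup x) \<rho> = VStar"
| "semp den (EDrop e) \<rho> = VStar"

primrec semt ::
  "('f \<Rightarrow> real list \<Rightarrow> real) \<Rightarrow> 'f exp \<Rightarrow> (primvar \<Rightarrow> vec) \<Rightarrow> (tanvar \<Rightarrow> vec) \<Rightarrow> vec" where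
  "semt den (EVar x y) \<rho> s = s y"
| "semt den (ELet x y e1 e2) \<rho> s =
     semt den e2 (\<rho>(x := semp den e1 \<rho>)) (s(y := semt den e1 \<rho> s))"
| "semt den EPUnit \<rho> s = VStar"
| "semt den ETUnit \<rho> s = VStar"
| "semt den (ELetPUnit z e) \<rho> s = semt den e \<rho> s"
| "semt den (ELetTUnit z e) \<rho> s = semt den e \<rho> s"
| "semt den (ETPair x1 x2) \<rho> s = VPair (s x1) (s x2)"
| "semt den (ELetTPair x1 x2 z e) \<rho> s =
     semt den e \<rho> (s(x1 := vfst (s z), x2 := vsnd (s z)))"
| "semt den (EZero \<tau>) \<rho> s = vzero \<tau>"
| "semt den (EAdd x y) \<rho> s = vadd (s x) (s y)"
| "semt den (EScale x y) \<rho> s = vscale (vreal (\<rho> x)) (s y)"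
| "semt den (EConst r) \<rho> s = VStar"
| "semt den (EFun f xs) \<rho> s = VStar"
| "semt den (EDup x) \<rho> s = VPair (s x) (s x)"
| "semt den (EDrop e) \<rho> s = VStar"


section \<open>The calculus\<close>

datatype ty =
    TyReal | TyLolli ty ty | TyOne | TyTensor ty ty | TyTop | TyWith ty ty | TyBang ty

primrec ty_p :: "lty \<Rightarrow> ty" where
  "ty_p LReal = TyReal"
| "ty_p LOne = TyOne"
| "ty_p (LTensor \<tau> \<sigma>) = TyTensor (TyBang (ty_p \<tau>)) (TyBang (ty_p \<sigma>))"

primrec ty_t :: "lty \<Rightarrow> ty" where
  "ty_t LReal = TyReal"
| "ty_t LOne = TyTop"
| "ty_t (LTensor \<tau> \<sigma>) = TyWith (ty_t \<tau>) (ty_t \<sigma>)"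

text \<open>
  Variables come in three disjoint families: the primal variables \<open>x\<close>, the variables \<open>u_y\<close>
  attached to the tangent variables \<open>y\<close>, and, at each type, an infinite supply of further
  variables. Reading the "fresh" variables of the translation off the last two families
  keeps them apart from the primal ones.
\<close>

datatype var = Prim primvar | Tang tanvar | Aux string ty

primrec vty :: "var \<Rightarrow> ty" where
  "vty (Prim x) = ty_p (pty x)"
| "vty (Tang y) = ty_t (tty y)"
| "vty (Aux n A) = A"

datatype (pvars: 'v) pat =
    PtVar 'v
  | PtBang 'v                        \<comment> \<open>\<open>!x\<close>\<close>
  | PtUnit
  | PtPair "'v pat" "'v pat"         \<comment> \<open>\<open>(p, q)\<close>\<close>
  | PtWith "'v pat" "'v pat"         \<comment> \<open>\<open>\<langle>p, q\<rangle>\<close>\<close>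

primrec linear_pat :: "'v pat \<Rightarrow> bool" where
  "linear_pat (PtVar x) \<longleftrightarrow> True"
| "linear_pat (PtBang x) \<longleftrightarrow> True"
| "linear_pat PtUnit \<longleftrightarrow> True"
| "linear_pat (PtPair p q) \<longleftrightarrow> linear_pat p \<and> linear_pat q \<and> pvars p \<inter> pvars q = {}"
| "linear_pat (PtWith p q) \<longleftrightarrow> linear_pat p \<and> linear_pat q \<and> pvars p \<inter> pvars q = {}"

datatype 'f tm =
    Var var
  | Bang "'f tm"
  | Lam "var pat" "'f tm"
  | App "'f tm" "'f tm"
  | Unit
  | Tensor "'f tm" "'f tm"             \<comment> \<open>\<open>(M, N)\<close>\<close>
  | Top                              \<comment> \<open>\<open>\<langle>\<rangle>\<close>\<close>
  | With "'f tm" "'f tm"             \<comment> \<open>\<open>\<langle>M, N\<rangle>\<close>\<close>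
  | Num real
  | Fun 'f
  | Plus
  | Times

text \<open>The terms of the grammar: in a pattern, no variable is repeated.\<close>

primrec is_term :: "'f tm \<Rightarrow> bool" where
  "is_term (Var x) \<longleftrightarrow> True"
| "is_term (Bang M) \<longleftrightarrow> is_term M"
| "is_term (Lam p M) \<longleftrightarrow> linear_pat p \<and> is_term M"
| "is_term (App M N) \<longleftrightarrow> is_term M \<and> is_term N"
| "is_term Unit \<longleftrightarrow> True"
| "is_term (Tensor M N) \<longleftrightarrow> is_term M \<and> is_term N"
| "is_term Top \<longleftrightarrow> True"
| "is_term (With M N) \<longleftrightarrow> is_term M \<and> is_term N"
| "is_term (Num r) \<longleftrightarrow> True"
| "is_term (Fun f) \<longleftrightarrow> True"
| "is_term Plus \<longleftrightarrow> True"
| "is_term Times \<longleftrightarrow> True"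

primrec fv :: "'f tm \<Rightarrow> var set" where
  "fv (Var x) = {x}"
| "fv (Bang M) = fv M"
| "fv (Lam p M) = fv M - pvars p"
| "fv (App M N) = fv M \<union> fv N"
| "fv Unit = {}"
| "fv (Tensor M N) = fv M \<union> fv N"
| "fv Top = {}"
| "fv (With M N) = fv M \<union> fv N"
| "fv (Num r) = {}"
| "fv (Fun f) = {}"
| "fv Plus = {}"
| "fv Times = {}"

text \<open>
  Simultaneous capture-avoiding substitution on named terms: \<open>avoid B A\<close> renames the bound
  variables \<open>A\<close>, keeping their types, so that they miss \<open>B\<close>; it leaves them alone if they
  already do. Since substitution renames, reduction is defined on named terms without further
  alpha-conversion steps; it is contained in reduction up to alpha-conversion.
\<close>

definition avoid :: "var set \<Rightarrow> var set \<Rightarrow> var \<Rightarrow> var" where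
  "avoid B A =
     (if A \<inter> B = {} then id
      else SOME r. inj_on r A \<and> r ` A \<inter> B = {} \<and> (\<forall>x\<in>A. vty (r x) = vty x))"

primrec subst :: "(var \<Rightarrow> 'f tm) \<Rightarrow> 'f tm \<Rightarrow> 'f tm" where
  "subst \<theta> (Var x) = \<theta> x"
| "subst \<theta> (Bang M) = Bang (subst \<theta> M)"
| "subst \<theta> (Lam p M) =
     (let r = avoid (\<Union>y\<in>fv M - pvars p. fv (\<theta> y)) (pvars p)
      in Lam (map_pat r p) (subst (\<lambda>y. if y \<in> pvars p then Var (r y) else \<theta> y) M))"
| "subst \<theta> (App M N) = App (subst \<theta> M) (subst \<theta> N)"
| "subst \<theta> Unit = Unit"
| "subst \<theta> (Tensor M N) = Tensor (subst \<theta> M) (subst \<theta> N)"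
| "subst \<theta> Top = Top"
| "subst \<theta> (With M N) = With (subst \<theta> M) (subst \<theta> N)"
| "subst \<theta> (Num r) = Num r"
| "subst \<theta> (Fun f) = Fun f"
| "subst \<theta> Plus = Plus"
| "subst \<theta> Times = Times"

text \<open>
  \<open>binds p V \<theta>\<close>: the term \<open>V\<close> is a value for \<open>p\<close>, and \<open>subst \<theta> M\<close> is \<open>M{V/p}\<close>.
\<close>

inductive binds :: "var pat \<Rightarrow> 'f tm \<Rightarrow> (var \<Rightarrow> 'f tm) \<Rightarrow> bool" where
  "binds (PtVar x) M (Var(x := M))"
| "binds (PtBang x) (Bang M) (Var(x := M))"
| "binds PtUnit Unit Var"
| "\<lbrakk>binds p V \<theta>; binds q W \<eta>\<rbrakk>
     \<Longrightarrow> binds (PtPair p q) (Tensor V W) (\<lambda>x. if x \<in> pvars p then \<theta> x else \<eta> x)"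
| "\<lbrakk>binds p V \<theta>; binds q W \<eta>\<rbrakk>
     \<Longrightarrow> binds (PtWith p q) (With V W) (\<lambda>x. if x \<in> pvars p then \<theta> x else \<eta> x)"

text \<open>Right-nested tuples of terms; function symbols have positive arity, so the case \<open>[]\<close> of
  \<open>pairs\<close> does not arise.\<close>

fun pairs :: "'f tm list \<Rightarrow> 'f tm" where
  "pairs [] = Unit"
| "pairs [M] = M"
| "pairs (M # N # Ms) = Tensor M (pairs (N # Ms))"

fun tuple :: "'f tm list \<Rightarrow> 'f tm" where
  "tuple [] = Top"
| "tuple [M] = M"
| "tuple (M # N # Ms) = With M (tuple (N # Ms))"

fun tuple_pat :: "var pat list \<Rightarrow> var pat" where
  "tuple_pat [] = PtVar (Aux ''u'' TyTop)"
| "tuple_pat [p] = p"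
| "tuple_pat (p # q # ps) = PtWith p (tuple_pat (q # ps))"

fun with_ty :: "ty list \<Rightarrow> ty" where
  "with_ty [] = TyTop"
| "with_ty [A] = A"
| "with_ty (A # B # As) = TyWith A (with_ty (B # As))"

inductive red :: "('f \<Rightarrow> nat) \<Rightarrow> ('f \<Rightarrow> real list \<Rightarrow> real) \<Rightarrow> 'f tm \<Rightarrow> 'f tm \<Rightarrow> bool"
  for ar :: "'f \<Rightarrow> nat" and den :: "'f \<Rightarrow> real list \<Rightarrow> real" where
  red_beta: "binds p V \<theta> \<Longrightarrow> red ar den (App (Lam p M) V) (subst \<theta> M)"
| red_fun: "length rs = ar f
     \<Longrightarrow> red ar den (App (Fun f) (pairs (map (\<lambda>r. Bang (Num r)) rs))) (Bang (Num (den f rs)))"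
| red_plus: "red ar den (App Plus (With (Num r) (Num s))) (Num (r + s))"
| red_times: "red ar den (App (App Times (Num r)) (Num s)) (Num (r * s))"
| red_Bang: "red ar den M M' \<Longrightarrow> red ar den (Bang M) (Bang M')"
| red_Lam: "red ar den M M' \<Longrightarrow> red ar den (Lam p M) (Lam p M')"
| red_App1: "red ar den M M' \<Longrightarrow> red ar den (App M N) (App M' N)"
| red_App2: "red ar den N N' \<Longrightarrow> red ar den (App M N) (App M N')"
| red_Pair1: "red ar den M M' \<Longrightarrow> red ar den (Tensor M N) (Tensor M' N)"
| red_Pair2: "red ar den N N' \<Longrightarrow> red ar den (Tensor M N) (Tensor M N')"
| red_With1: "red ar den M M' \<Longrightarrow> red ar den (With M N) (With M' N)"
| red_With2: "red ar den N N' \<Longrightarrow> red ar den (With M N) (With M N')"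

abbreviation reds :: "('f \<Rightarrow> nat) \<Rightarrow> ('f \<Rightarrow> real list \<Rightarrow> real) \<Rightarrow> 'f tm \<Rightarrow> 'f tm \<Rightarrow> bool" where
  "reds ar den \<equiv> (red ar den)\<^sup>*\<^sup>*"

definition Let_tm :: "var pat \<Rightarrow> 'f tm \<Rightarrow> 'f tm \<Rightarrow> 'f tm" where
  "Let_tm p N M = App (Lam p M) N"

definition par :: "'f tm \<Rightarrow> 'f tm" where
  "par M = With Unit M"

definition par_pat :: "var pat \<Rightarrow> var pat" where
  "par_pat p = PtWith PtUnit p"

text \<open>The next three functions are only meaningful on types built from \<open>TyReal\<close>, \<open>TyTop\<close> and
  \<open>TyWith\<close>.\<close>

fun zero_tm :: "ty \<Rightarrow> 'f tm" where
  "zero_tm TyReal = Num 0"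
| "zero_tm TyTop = Top"
| "zero_tm (TyWith H K) = With (zero_tm H) (zero_tm K)"

fun plus_tm :: "ty \<Rightarrow> 'f tm" where
  "plus_tm TyReal = Plus"
| "plus_tm TyTop =
     Lam (PtWith (PtVar (Aux ''h'' TyTop)) (PtVar (Aux ''h1'' TyTop))) Top"
| "plus_tm (TyWith H K) =
     (let h = Aux ''h'' H; k = Aux ''k'' K; h1 = Aux ''h1'' H; k1 = Aux ''k1'' K
      in Lam (PtWith (PtWith (PtVar h) (PtVar k)) (PtWith (PtVar h1) (PtVar k1)))
           (With (App (plus_tm H) (With (Var h) (Var h1)))
                 (App (plus_tm K) (With (Var k) (Var k1)))))"

fun times_tm :: "ty \<Rightarrow> var \<Rightarrow> 'f tm" where
  "times_tm TyReal x = App Times (Var x)"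
| "times_tm TyTop x = Lam (PtVar (Aux ''h'' TyTop)) Top"
| "times_tm (TyWith H K) x =
     (let h = Aux ''h'' H; k = Aux ''k'' K
      in Lam (PtWith (PtVar h) (PtVar k))
           (With (App (times_tm H x) (Var h)) (App (times_tm K x) (Var k))))"

primrec enc_p :: "vec \<Rightarrow> 'f tm" where
  "enc_p (VReal r) = Num r"
| "enc_p VStar = Unit"
| "enc_p (VPair a b) = Tensor (Bang (enc_p a)) (Bang (enc_p b))"

primrec enc_t :: "vec \<Rightarrow> 'f tm" where
  "enc_t (VReal r) = Num r"
| "enc_t VStar = Top"
| "enc_t (VPair a b) = With (enc_t a) (enc_t b)"


section \<open>The translation\<close>

abbreviation uvar :: "tanvar \<Rightarrow> 'f tm" where
  "uvar y \<equiv> Var (Tang y)"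

abbreviation u_tuple :: "tanvar list \<Rightarrow> 'f tm" where
  "u_tuple ys \<equiv> tuple (map uvar ys)"

abbreviation u_pat :: "tanvar list \<Rightarrow> var pat" where
  "u_pat ys \<equiv> tuple_pat (map (\<lambda>y. PtVar (Tang y)) ys)"

text \<open>The type of the linear map in the translation of an expression with tangent variables \<open>ys\<close>
  and tangent type \<open>\<sigma>\<close>.\<close>

abbreviation lin_ty :: "tanvar list \<Rightarrow> lty \<Rightarrow> ty" where
  "lin_ty ys \<sigma> \<equiv> TyLolli (with_ty (map (\<lambda>y. ty_t (tty y)) ys)) (ty_t \<sigma>)"

abbreviation const_top :: "'f tm \<Rightarrow> 'f tm" where
  "const_top M \<equiv> Lam (PtVar (Aux ''y'' TyTop)) M"

text \<open>
  In the case of \<open>let (x; y) = e1 in e2\<close>, the bound variable \<open>y\<close> is removed from \<open>fvt e2\<close>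
  before restricting \<open>ys\<close>: bound names may coincide with free ones here, so \<open>y\<close> may occur in
  \<open>ys\<close> as a free variable of \<open>e1\<close>.
\<close>

primrec delta :: "'f exp \<Rightarrow> tanvar list \<Rightarrow> 'f tm" where
  "delta (EVar x y) ys = Tensor (Bang (Var (Prim x))) (par (Lam (u_pat ys) (uvar y)))"
| "delta (ELet x y e1 e2) ys =
     (let ys1 = filter (\<lambda>w. w \<in> fvt e1) ys;
          ys2 = filter (\<lambda>w. w \<in> fvt e2 - {y}) ys;
          f = Aux ''f'' (lin_ty ys1 (tty_exp e1));
          g = Aux ''g'' (lin_ty (y # ys2) (tty_exp e2));
          z = Aux ''z'' (ty_p (pty_exp e2))
      in Let_tm (PtPair (PtBang (Prim x)) (par_pat (PtVar f))) (delta e1 ys1)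
          (Let_tm (PtPair (PtBang z) (par_pat (PtVar g))) (delta e2 (y # ys2))
            (Tensor (Bang (Var z))
               (par (Lam (u_pat ys)
                  (App (Var g) (tuple (App (Var f) (u_tuple ys1) # map uvar ys2))))))))"
| "delta EPUnit ys = Tensor (Bang Unit) (par (const_top Top))"
| "delta ETUnit ys = Tensor (Bang Unit) (par (const_top Top))"
| "delta (ELetPUnit z e) ys = Let_tm PtUnit (Var (Prim z)) (delta e ys)"
| "delta (ELetTUnit z e) ys =
     (let ys' = filter (\<lambda>w. w \<noteq> z) ys;
          f = Aux ''f'' (lin_ty ys' (tty_exp e));
          x = Aux ''x'' (ty_p (pty_exp e))
      in Let_tm (PtPair (PtBang x) (par_pat (PtVar f))) (delta e ys')
           (Tensor (Bang (Var x)) (par (Lam (u_pat ys) (App (Var f) (u_tuple ys'))))))"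
| "delta (ETPair x1 x2) ys = Tensor (Bang Unit) (par (Lam (u_pat ys) (With (uvar x1) (uvar x2))))"
| "delta (ELetTPair y1 y2 z e) ys =
     (let ys' = filter (\<lambda>w. w \<noteq> z) ys;
          f = Aux ''f'' (lin_ty (y1 # y2 # ys') (tty_exp e));
          x = Aux ''x'' (ty_p (pty_exp e));
          x1 = Aux ''x1'' (ty_t (tty y1));
          x2 = Aux ''x2'' (ty_t (tty y2))
      in Let_tm (PtPair (PtBang x) (par_pat (PtVar f))) (delta e (y1 # y2 # ys'))
           (Tensor (Bang (Var x))
              (par (Lam (tuple_pat (map (\<lambda>w. if w = z then PtWith (PtVar x1) (PtVar x2)
                                             else PtVar (Tang w)) ys))
                 (App (Var f) (tuple (Var x1 # Var x2 # map uvar ys')))))))"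
| "delta (EZero \<sigma>) ys = Tensor (Bang Unit) (par (const_top (zero_tm (ty_t \<sigma>))))"
| "delta (EAdd y1 y2) ys =
     Tensor (Bang Unit)
       (par (Lam (u_pat ys) (App (plus_tm (ty_t (tty y1))) (With (uvar y1) (uvar y2)))))"
| "delta (EScale x y) ys =
     Tensor (Bang Unit) (par (Lam (u_pat ys) (App (times_tm (ty_t (tty y)) (Prim x)) (uvar y))))"
| "delta (EConst r) ys = Tensor (Bang (Num r)) (par (const_top Top))"
| "delta (EFun f xs) ys =
     Tensor (App (Fun f) (pairs (map (\<lambda>x. Bang (Var (Prim x))) xs))) (par (const_top Top))"
| "delta (EDup y) ys = Tensor (Bang Unit) (par (Lam (u_pat ys) (With (uvar y) (uvar y))))"
| "delta (EDrop e) ys =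
     (let A = with_ty (map (\<lambda>y. ty_t (tty y)) ys);
          f = Aux ''f'' (lin_ty ys (tty_exp e));
          x = Aux ''x'' (ty_p (pty_exp e));
          y = Aux ''y'' A;
          z = Aux ''z'' (ty_t (tty_exp e))
      in Let_tm (PtPair (PtBang x) (par_pat (PtVar f))) (delta e ys)
           (Tensor (Bang Unit)
              (par (Lam (PtVar y) (Let_tm (PtVar z) (App (Var f) (Var y)) Top)))))"

definition prim_subst :: "primvar set \<Rightarrow> (primvar \<Rightarrow> vec) \<Rightarrow> var \<Rightarrow> 'f tm" where
  "prim_subst \<Gamma> \<rho> v =
     (case v of Prim x \<Rightarrow> if x \<in> \<Gamma> then enc_p (\<rho> x) else Var v | _ \<Rightarrow> Var v)"

end

theory Submission
  imports Defs
begin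

text \<open>
  The proof is by induction on the typing derivation, with the extra invariant that \<open>F\<close> is closed.
  A translated expression has only primal variables free, and these are instantiated by
  closed encodings; so every value substituted along the evaluation of the nested
  \<open>let\<close>s is closed, substitution never renames, and consecutive substitutions merge into a single
  one.
\<close>

section \<open>Substitution of closed terms\<close>

text \<open>The obstacle is the \<open>Lam\<close> clause of \<open>subst\<close>: it renames by an
  arbitrary choice, so a reduct in which a renaming took place has no explicit form. The linear map
  \<open>F\<close> obtained for a subexpression is inserted under the binder of the enclosing linear
  map, which is why its closedness has to be carried through the induction. A \<open>closing\<close>
  substitution is one that is safe under every binder; its images may also be the variable itself,
  because a substitution acts as the identity outside its support.

  \<open>F\<close> has to be found before any tangent assignment is given: the evaluation of the
  lets stops at a pair that contains an unapplied abstraction, whose body is run only on the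
  encodings of a given \<open>s\<close>. The induction statement therefore fixes \<open>F\<close>
  first and quantifies over \<open>s\<close> afterwards.

  Scopes also disagree: the substitution in force when a subexpression is evaluated covers further
  primal variables and the auxiliary variables of outer lets, while the induction hypothesis speaks
  of the subexpression's own context. The bound on the free variables of \<open>delta\<close>
  bridges this gap.\<close>

definition closing :: "(var \<Rightarrow> 'f tm) \<Rightarrow> bool" where
  "closing \<theta> \<longleftrightarrow> (\<forall>y. fv (\<theta> y) = {} \<or> \<theta> y = Var y)"

text \<open>This is what a closing substitution becomes when it passes under a binder of the
  variables \<open>A\<close>.\<close>

definition mask :: "var set \<Rightarrow> (var \<Rightarrow> 'f tm) \<Rightarrow> var \<Rightarrow> 'f tm" where
  "mask A \<theta> y = (if y \<in> A then Var y else \<theta> y)"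

lemma closing_Var [simp]: "closing Var"
  by (simp add: closing_def)

lemma closing_fun_upd [simp]: "closing \<theta> \<Longrightarrow> fv V = {} \<Longrightarrow> closing (\<theta>(x := V))"
  by (simp add: closing_def)

lemma closing_mask [simp]: "closing \<theta> \<Longrightarrow> closing (mask A \<theta>)"
  by (simp add: closing_def mask_def)

lemma closing_override: "closing \<theta> \<Longrightarrow> closing \<eta> \<Longrightarrow> closing (\<lambda>y. if y \<in> A then \<eta> y else \<theta> y)"
  by (simp add: closing_def)

text \<open>The free variables of \<open>\<theta> y\<close> lie in \<open>{y}\<close>, so the images
  of the variables free in the abstraction miss the bound ones and \<open>avoid\<close> returns the
  identity. This replaces the defining clause from here on.\<close>

lemma subst_Lam_closing:
  assumes "closing \<theta>"
  shows "subst \<theta> (Lam p M) = Lam p (subst (mask (pvars p) \<theta>) M)"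
proof -
  have "fv (\<theta> y) \<subseteq> {y}" for y
    using assms unfolding closing_def by (metis empty_subsetI fv.simps(1) order_refl)
  then have "pvars p \<inter> (\<Union>y\<in>fv M - pvars p. fv (\<theta> y)) = {}"
    by blast
  then have "avoid (\<Union>y\<in>fv M - pvars p. fv (\<theta> y)) (pvars p) = id"
    by (simp add: avoid_def)
  then show ?thesis
    by (simp add: mask_def[abs_def] pat.map_id cong: if_cong)
qed

declare subst.simps(3) [simp del]

lemma subst_cong: "(\<And>y. y \<in> fv M \<Longrightarrow> \<theta> y = \<eta> y) \<Longrightarrow> subst \<theta> M = subst \<eta> M"
proof (induction M arbitrary: \<theta> \<eta>)
  case (Lam p M)
  \<comment> \<open>The renaming picked by \<open>avoid\<close> depends on the substitution only
    through this set, so both sides rename alike.\<close>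
  have "(\<Union>y\<in>fv M - pvars p. fv (\<theta> y)) = (\<Union>y\<in>fv M - pvars p. fv (\<eta> y))"
    using Lam.prems by simp
  moreover have "subst (\<lambda>y. if y \<in> pvars p then Var (r y) else \<theta> y) M
      = subst (\<lambda>y. if y \<in> pvars p then Var (r y) else \<eta> y) M" for r
    using Lam.prems by (intro Lam.IH) simp
  ultimately show ?case
    by (simp only: subst.simps(3) Let_def)
next
  case (Bang M) then show ?case by (metis fv.simps(2) subst.simps(2))
next
  case (App M N) then show ?case by (metis UnCI fv.simps(4) subst.simps(4))
next
  case (Tensor M N) then show ?case by (metis UnCI fv.simps(6) subst.simps(6))
next
  case (With M N) then show ?case by (metis UnCI fv.simps(8) subst.simps(8))
qed simp_all

lemma mask_Var [simp]: "mask A Var = Var"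
  by (simp add: mask_def fun_eq_iff)

lemma subst_Var [simp]: "subst Var M = M"
  by (induction M) (simp_all add: subst_Lam_closing)

lemma subst_closed [simp]: "fv M = {} \<Longrightarrow> subst \<theta> M = M"
  by (metis empty_iff subst_Var subst_cong)

lemma subst_subst:
  "closing \<theta> \<Longrightarrow> closing \<eta> \<Longrightarrow> subst \<theta> (subst \<eta> M) = subst (\<lambda>y. subst \<theta> (\<eta> y)) M"
proof (induction M arbitrary: \<theta> \<eta>)
  case (Lam p M)
  let ?\<zeta> = "\<lambda>y. subst \<theta> (\<eta> y)"
  have "closing ?\<zeta>"
    unfolding closing_def
  proof
    fix y
    have "fv (\<eta> y) = {} \<or> \<eta> y = Var y" "fv (\<theta> y) = {} \<or> \<theta> y = Var y"
      using Lam.prems by (simp_all add: closing_def)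
    then show "fv (?\<zeta> y) = {} \<or> ?\<zeta> y = Var y"
      by auto
  qed
  \<comment> \<open>On the pattern both masks keep the variable. Elsewhere \<open>\<eta> y\<close>
    is closed, hence fixed by any substitution, or it is \<open>y\<close>, which the mask does not
    affect.\<close>
  moreover have "(\<lambda>y. subst (mask (pvars p) \<theta>) (mask (pvars p) \<eta> y)) = mask (pvars p) ?\<zeta>"
  proof
    fix y
    have "fv (\<eta> y) = {} \<or> \<eta> y = Var y"
      using Lam.prems by (simp add: closing_def)
    then show "subst (mask (pvars p) \<theta>) (mask (pvars p) \<eta> y) = mask (pvars p) ?\<zeta> y"
      by (auto simp: mask_def)
  qed
  ultimately show ?case
    using Lam by (simp add: subst_Lam_closing)
qed auto

lemma binds_outside: "binds p V \<theta> \<Longrightarrow> x \<notin> pvars p \<Longrightarrow> \<theta> x = Var x"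
  by (induction arbitrary: x rule: binds.induct) auto

lemma binds_closing: "binds p V \<theta> \<Longrightarrow> fv V = {} \<Longrightarrow> closing \<theta>"
  by (induction rule: binds.induct) (simp_all add: closing_override)

text \<open>In \<open>binds\<close> the left component of a pair pattern takes precedence, in a
  chain of updates the last one does; the two agree because the variables differ.\<close>

lemma binds_let_pat:
  assumes "x \<noteq> f"
  shows "binds (PtPair (PtBang x) (par_pat (PtVar f))) (Tensor (Bang V) (par F))
     (Var(x := V, f := F))"
proof -
  have "binds (PtPair (PtBang x) (par_pat (PtVar f))) (Tensor (Bang V) (par F))
     (\<lambda>v. if v \<in> pvars (PtBang x) then (Var(x := V)) v
       else (\<lambda>v. if v \<in> pvars PtUnit then Var v else (Var(f := F)) v) v)"
    unfolding par_pat_def par_def by (intro binds.intros)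
  also have "(\<lambda>v. if v \<in> pvars (PtBang x) then (Var(x := V)) v
       else (\<lambda>v. if v \<in> pvars PtUnit then Var v else (Var(f := F)) v) v) = Var(x := V, f := F)"
    using assms by (auto simp: fun_eq_iff)
  finally show ?thesis .
qed

text \<open>A redex under a pending substitution contracts to the body under one combined
  substitution. Closedness of \<open>V\<close> makes \<open>\<eta>\<close> closing, so the two
  substitutions merge, and \<open>\<eta>\<close> fixes all variables outside the pattern.\<close>

lemma red_beta_closed:
  assumes "closing \<theta>" "binds p V \<eta>" "fv V = {}"
  shows "red ar den (App (subst \<theta> (Lam p M)) V)
           (subst (\<lambda>y. if y \<in> pvars p then \<eta> y else \<theta> y) M)"
proof -
  have "red ar den (App (subst \<theta> (Lam p M)) V) (subst \<eta> (subst (mask (pvars p) \<theta>) M))"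
    unfolding subst_Lam_closing[OF assms(1)] using assms(2) by (rule red_beta)
  also have "subst \<eta> (subst (mask (pvars p) \<theta>) M)
      = subst (\<lambda>y. subst \<eta> (mask (pvars p) \<theta> y)) M"
    using assms(1) binds_closing[OF assms(2,3)] by (intro subst_subst) auto
  also have "(\<lambda>y. subst \<eta> (mask (pvars p) \<theta> y)) = (\<lambda>y. if y \<in> pvars p then \<eta> y else \<theta> y)"
  proof
    fix y
    have "fv (\<theta> y) = {} \<or> \<theta> y = Var y"
      using assms(1) by (simp add: closing_def)
    then show "subst \<eta> (mask (pvars p) \<theta> y) = (if y \<in> pvars p then \<eta> y else \<theta> y)"
      using binds_outside[OF assms(2)] by (auto simp: mask_def)
  qed
  finally show ?thesis .
qed

section \<open>Chains of reductions and congruence\<close>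

text \<open>
  First-order calculation rules: with the generic substitution rules, a chain of reductions
  between large terms sets off an explosive higher-order unification.
\<close>

lemma reds_calc [trans]:
  "red ar den M N \<Longrightarrow> red ar den N K \<Longrightarrow> reds ar den M K"
  "red ar den M N \<Longrightarrow> reds ar den N K \<Longrightarrow> reds ar den M K"
  "reds ar den M N \<Longrightarrow> red ar den N K \<Longrightarrow> reds ar den M K"
  "reds ar den M N \<Longrightarrow> reds ar den N K \<Longrightarrow> reds ar den M K"
  "red ar den M N \<Longrightarrow> N = K \<Longrightarrow> red ar den M K"
  "reds ar den M N \<Longrightarrow> N = K \<Longrightarrow> reds ar den M K"
  "M = N \<Longrightarrow> red ar den N K \<Longrightarrow> red ar den M K"
  "M = N \<Longrightarrow> reds ar den N K \<Longrightarrow> reds ar den M K"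
  by auto

lemma reds_App2: "reds ar den N N' \<Longrightarrow> reds ar den (App M N) (App M N')"
  by (induction rule: rtranclp_induct) (auto intro: red_App2 rtranclp.rtrancl_into_rtrancl)

lemma reds_With:
  assumes "reds ar den M M'" "reds ar den N N'"
  shows "reds ar den (With M N) (With M' N')"
proof -
  have "reds ar den (With M N) (With M' N)"
    using assms(1)
    by (induction rule: rtranclp_induct) (auto intro: red_With1 rtranclp.rtrancl_into_rtrancl)
  also have "reds ar den \<dots> (With M' N')"
    using assms(2)
    by (induction rule: rtranclp_induct) (auto intro: red_With2 rtranclp.rtrancl_into_rtrancl)
  finally show ?thesis .
qed

text \<open>In the translation of a let, the argument of \<open>g\<close> has a single component
  left to evaluate, the first one, \<open>f\<close> applied to its tuple.\<close>

lemma reds_tuple_hd: "reds ar den M M' \<Longrightarrow> reds ar den (tuple (M # Ms)) (tuple (M' # Ms))"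
  by (cases Ms) (auto intro: reds_With)

text \<open>Each let of the translation is executed by this rule: evaluate the bound term, then
  record its primal value and its linear map as two updates of the substitution, without computing
  the intermediate term.\<close>

lemma reds_let:
  assumes "closing \<theta>" "reds ar den (subst \<theta> N) (Tensor (Bang V) (par F))"
    and "fv V = {}" "fv F = {}" "x \<noteq> f"
  shows "reds ar den (subst \<theta> (Let_tm (PtPair (PtBang x) (par_pat (PtVar f))) N M))
           (subst (\<theta>(x := V, f := F)) M)"
proof -
  let ?p = "PtPair (PtBang x) (par_pat (PtVar f))"
  have eq: "(\<lambda>y. if y \<in> pvars ?p then (Var(x := V, f := F)) y else \<theta> y) = \<theta>(x := V, f := F)"
    by (auto simp: par_pat_def fun_eq_iff)
  have "fv (Tensor (Bang V) (par F)) = {}"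
    using assms by (simp add: par_def)
  from red_beta_closed[OF assms(1) binds_let_pat[OF assms(5)] this, of ar den M]
  have "red ar den (App (subst \<theta> (Lam ?p M)) (Tensor (Bang V) (par F))) (subst (\<theta>(x := V, f := F)) M)"
    unfolding eq .
  with reds_App2[OF assms(2)] show ?thesis
    unfolding Let_tm_def subst.simps(4) by (rule rtranclp.rtrancl_into_rtrancl)
qed

section \<open>Tuples\<close>

lemma subst_tuple [simp]: "subst \<theta> (tuple Ms) = tuple (map (subst \<theta>) Ms)"
  by (induction Ms rule: tuple.induct) auto

lemma subst_pairs [simp]: "subst \<theta> (pairs Ms) = pairs (map (subst \<theta>) Ms)"
  by (induction Ms rule: pairs.induct) auto

lemma fv_tuple [simp]: "fv (tuple Ms) = (\<Union>M\<in>set Ms. fv M)"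
  by (induction Ms rule: tuple.induct) auto

lemma fv_pairs [simp]: "fv (pairs Ms) = (\<Union>M\<in>set Ms. fv M)"
  by (induction Ms rule: pairs.induct) auto

lemma is_term_tuple [simp]: "is_term (tuple Ms) \<longleftrightarrow> (\<forall>M\<in>set Ms. is_term M)"
  by (induction Ms rule: tuple.induct) auto

lemma pvars_tuple_pat:
  "pvars (tuple_pat ps) = (if ps = [] then {Aux ''u'' TyTop} else (\<Union>p\<in>set ps. pvars p))"
  by (induction ps rule: tuple_pat.induct) auto

lemma pvars_u_pat: "pvars (u_pat ys) = (if ys = [] then {Aux ''u'' TyTop} else Tang ` set ys)"
  by (auto simp: pvars_tuple_pat)

text \<open>The components \<open>P y\<close> are arbitrary patterns because, in the translation of
  a tangent pair elimination, one of them is itself a pair pattern.\<close>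

lemma linear_tuple_pat:
  assumes "distinct ys" "\<And>y. y \<in> set ys \<Longrightarrow> linear_pat (P y)"
    and "\<And>y y'. y \<in> set ys \<Longrightarrow> y' \<in> set ys \<Longrightarrow> y \<noteq> y' \<Longrightarrow> pvars (P y) \<inter> pvars (P y') = {}"
  shows "linear_pat (tuple_pat (map P ys))"
  using assms
proof (induction ys rule: induct_list012)
  case (3 y y' ys)
  have "linear_pat (tuple_pat (map P (y' # ys)))"
    using "3.prems" by (intro "3.IH"(2)) auto
  moreover have "pvars (P y) \<inter> pvars (tuple_pat (map P (y' # ys))) = {}"
    using "3.prems"(1) "3.prems"(3)[of y] by (fastforce simp: pvars_tuple_pat)
  ultimately show ?case
    using "3.prems"(2) by simp
qed auto

lemma linear_u_pat: "distinct ys \<Longrightarrow> linear_pat (u_pat ys)"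
  by (rule linear_tuple_pat) auto

text \<open>Disjointness of the components keeps the precedence of earlier components in
  \<open>binds\<close> from overriding later bindings. Nothing is claimed outside the variables of
  the components; in particular the spare variable that stands for the empty tuple pattern is left
  unspecified.\<close>

lemma binds_tuple_pat:
  assumes "distinct ys" "\<And>y. y \<in> set ys \<Longrightarrow> binds (P y) (V y) (\<eta> y)"
    and "\<And>y y'. y \<in> set ys \<Longrightarrow> y' \<in> set ys \<Longrightarrow> y \<noteq> y' \<Longrightarrow> pvars (P y) \<inter> pvars (P y') = {}"
  shows "\<exists>\<theta>. binds (tuple_pat (map P ys)) (tuple (map V ys)) \<theta> \<and>
           (\<forall>y\<in>set ys. \<forall>v\<in>pvars (P y). \<theta> v = \<eta> y v)"
  using assms
proof (induction ys rule: induct_list012)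
  case 1
  show ?case
    using binds.intros(1) by fastforce
next
  case (2 y)
  then show ?case by auto
next
  case (3 y y' ys)
  have "\<exists>\<theta>. binds (tuple_pat (map P (y' # ys))) (tuple (map V (y' # ys))) \<theta> \<and>
           (\<forall>w\<in>set (y' # ys). \<forall>v\<in>pvars (P w). \<theta> v = \<eta> w v)"
    using "3.prems" by (intro "3.IH"(2)) auto
  then obtain \<theta> where \<theta>: "binds (tuple_pat (map P (y' # ys))) (tuple (map V (y' # ys))) \<theta>"
      "\<forall>w\<in>set (y' # ys). \<forall>v\<in>pvars (P w). \<theta> v = \<eta> w v"
    by blast
  have b: "binds (P y) (V y) (\<eta> y)"
    using "3.prems"(2) by simp
  let ?\<theta> = "\<lambda>v. if v \<in> pvars (P y) then \<eta> y v else \<theta> v"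
  have "binds (tuple_pat (map P (y # y' # ys))) (tuple (map V (y # y' # ys))) ?\<theta>"
    using binds.intros(5)[OF b \<theta>(1)] by simp
  moreover have "?\<theta> v = \<eta> w v" if "w \<in> set (y # y' # ys)" "v \<in> pvars (P w)" for w v
  proof (cases "w = y")
    case False
    then have "v \<notin> pvars (P y)"
      using that "3.prems"(3)[of y w] by auto
    then show ?thesis
      using that False \<theta>(2) by auto
  qed (use that in auto)
  ultimately show ?case
    by blast
qed

lemma red_beta_u_pat:
  assumes "distinct ys"
  obtains \<theta> where "red ar den (App (Lam (u_pat ys) M) (tuple (map V ys))) (subst \<theta> M)"
    and "\<And>y. y \<in> set ys \<Longrightarrow> \<theta> (Tang y) = V y"
proof -
  have "\<exists>\<theta>. binds (u_pat ys) (tuple (map V ys)) \<theta> \<and>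
      (\<forall>y\<in>set ys. \<forall>v\<in>pvars (PtVar (Tang y)). \<theta> v = (Var(Tang y := V y)) v)"
    by (rule binds_tuple_pat[where \<eta> = "\<lambda>y. Var(Tang y := V y)", OF assms binds.intros(1)]) auto
  then obtain \<theta> where "binds (u_pat ys) (tuple (map V ys)) \<theta>" "\<forall>y\<in>set ys. \<theta> (Tang y) = V y"
    by auto
  then show ?thesis
    using that red_beta by metis
qed

section \<open>Encodings and the vector operations\<close>

lemma fv_enc_p [simp]: "fv (enc_p a) = {}"
  by (induction a) auto

lemma fv_enc_t [simp]: "fv (enc_t a) = {}"
  by (induction a) auto

text \<open>Read from right to left, this makes \<open>zero_tm\<close> an encoding, so that its
  closedness and well-formedness come from those of encodings.\<close>

lemma enc_t_vzero: "enc_t (vzero \<tau>) = zero_tm (ty_t \<tau>)"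
  by (induction \<tau>) auto

lemma is_term_enc_t [simp]: "is_term (enc_t a)"
  by (induction a) auto

lemma is_term_enc_p [simp]: "is_term (enc_p a)"
  by (induction a) auto

lemma fv_plus_tm [simp]: "fv (plus_tm (ty_t \<tau>)) = {}"
  by (induction \<tau>) (auto simp: Let_def)

lemma is_term_plus_tm: "is_term (plus_tm (ty_t \<tau>))"
  by (induction \<tau>) (auto simp: Let_def)

lemma fv_times_tm: "fv (times_tm (ty_t \<tau>) x) \<subseteq> {x}"
  by (induction \<tau>) (auto simp: Let_def)

lemma reds_plus_tm:
  "a \<in> vecs \<tau> \<Longrightarrow> b \<in> vecs \<tau> \<Longrightarrow>
    reds ar den (App (plus_tm (ty_t \<tau>)) (With (enc_t a) (enc_t b))) (enc_t (vadd a b))"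
proof (induction \<tau> arbitrary: a b)
  case LReal
  then show ?case
    by (auto intro!: r_into_rtranclp red_plus)
next
  case LOne
  have "red ar den (App (plus_tm TyTop) (With Top Top)) (subst
     (\<lambda>v. if v \<in> pvars (PtVar (Aux ''h'' TyTop)) then (Var(Aux ''h'' TyTop := Top)) v
          else (Var(Aux ''h1'' TyTop := Top)) v) Top)"
    unfolding plus_tm.simps by (intro red_beta binds.intros)
  then show ?case
    using LOne by (auto intro!: r_into_rtranclp)
next
  case (LTensor \<tau> \<sigma>)
  then obtain a1 a2 b1 b2 where eq: "a = VPair a1 a2" "b = VPair b1 b2"
    and v: "a1 \<in> vecs \<tau>" "a2 \<in> vecs \<sigma>" "b1 \<in> vecs \<tau>" "b2 \<in> vecs \<sigma>"
    by auto
  let ?H = "ty_t \<tau>" and ?K = "ty_t \<sigma>"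
  let ?B = "With (App (plus_tm ?H) (With (Var (Aux ''h'' ?H)) (Var (Aux ''h1'' ?H))))
                 (App (plus_tm ?K) (With (Var (Aux ''k'' ?K)) (Var (Aux ''k1'' ?K)))) :: 'a tm"
  let ?p = "PtWith (PtVar (Aux ''h'' ?H)) (PtVar (Aux ''k'' ?K))"
  let ?q = "PtWith (PtVar (Aux ''h1'' ?H)) (PtVar (Aux ''k1'' ?K))"
  let ?\<theta> = "(\<lambda>v. if v \<in> pvars ?p then
         (if v \<in> pvars (PtVar (Aux ''h'' ?H)) then (Var(Aux ''h'' ?H := enc_t a1)) v
          else (Var(Aux ''k'' ?K := enc_t a2)) v)
       else (if v \<in> pvars (PtVar (Aux ''h1'' ?H)) then (Var(Aux ''h1'' ?H := enc_t b1)) v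
          else (Var(Aux ''k1'' ?K := enc_t b2)) v))"
  have "red ar den (App (plus_tm (TyWith ?H ?K)) (With (With (enc_t a1) (enc_t a2)) (With (enc_t b1) (enc_t b2))))
     (subst ?\<theta> ?B)"
    unfolding plus_tm.simps Let_def by (intro red_beta binds.intros)
  \<comment> \<open>The inner sums are closed, so only the four component variables are replaced.
    Their strings keep them apart even when the two types coincide.\<close>
  also have "subst ?\<theta> ?B = With (App (plus_tm ?H) (With (enc_t a1) (enc_t b1)))
      (App (plus_tm ?K) (With (enc_t a2) (enc_t b2)))"
    by simp
  also have "reds ar den \<dots> (With (enc_t (vadd a1 b1)) (enc_t (vadd a2 b2)))"
    using v by (intro reds_With LTensor.IH)
  finally show ?case
    by (simp add: eq)
qed

text \<open>The scalar is a free variable of \<open>times_tm\<close> and is met again under the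
  abstraction at every product type. The induction therefore needs an arbitrary closing
  \<open>\<theta>\<close> that sends it to \<open>Num r\<close>, a condition which survives the
  bindings of \<open>h\<close> and \<open>k\<close>.\<close>

lemma reds_times_tm:
  assumes "closing \<theta>" "\<theta> (Prim x) = Num r" "a \<in> vecs \<tau>"
  shows "reds ar den (App (subst \<theta> (times_tm (ty_t \<tau>) (Prim x))) (enc_t a)) (enc_t (vscale r a))"
  using assms
proof (induction \<tau> arbitrary: a \<theta>)
  case LReal
  then show ?case
    by (auto intro!: r_into_rtranclp red_times)
next
  case LOne
  then show ?case
    by (auto simp: subst_Lam_closing intro!: r_into_rtranclp red_beta[where M=Top, simplified] binds.intros)
next
  case (LTensor \<tau> \<sigma>)
  then obtain a1 a2 where eq: "a = VPair a1 a2" and v: "a1 \<in> vecs \<tau>" "a2 \<in> vecs \<sigma>"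
    by auto
  let ?H = "ty_t \<tau>" and ?K = "ty_t \<sigma>"
  let ?h = "Aux ''h'' ?H" and ?k = "Aux ''k'' ?K"
  let ?B = "With (App (times_tm ?H (Prim x)) (Var ?h)) (App (times_tm ?K (Prim x)) (Var ?k)) :: 'a tm"
  let ?p = "PtWith (PtVar ?h) (PtVar ?k)"
  let ?\<theta> = "\<lambda>v. if v \<in> pvars ?p then
         (if v \<in> pvars (PtVar ?h) then (Var(?h := enc_t a1)) v else (Var(?k := enc_t a2)) v)
       else \<theta> v"
  have cl: "closing ?\<theta>"
    using LTensor.prems by (intro closing_override closing_fun_upd) auto
  have "red ar den (App (subst \<theta> (Lam ?p ?B)) (With (enc_t a1) (enc_t a2))) (subst ?\<theta> ?B)"
    using LTensor.prems by (intro red_beta_closed binds.intros) auto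
  also have "subst ?\<theta> ?B = With (App (subst ?\<theta> (times_tm ?H (Prim x))) (enc_t a1))
      (App (subst ?\<theta> (times_tm ?K (Prim x))) (enc_t a2))"
    by simp
  also have "reds ar den \<dots> (With (enc_t (vscale r a1)) (enc_t (vscale r a2)))"
    using v cl LTensor.prems by (intro reds_With LTensor.IH) auto
  finally show ?case
    by (simp add: eq Let_def)
qed

lemma is_term_subst_times_tm:
  "closing \<theta> \<Longrightarrow> is_term (\<theta> (Prim x)) \<Longrightarrow> is_term (subst \<theta> (times_tm (ty_t \<tau>) (Prim x)))"
  by (induction \<tau> arbitrary: \<theta>) (auto simp: Let_def subst_Lam_closing mask_def)

lemma fv_subst_times_tm:
  "closing \<theta> \<Longrightarrow> fv (\<theta> (Prim x)) = {} \<Longrightarrow> fv (subst \<theta> (times_tm (ty_t \<tau>) (Prim x))) = {}"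
  by (induction \<tau> arbitrary: \<theta>) (auto simp: Let_def subst_Lam_closing mask_def)

section \<open>Type preservation of the vector operations and of the semantics\<close>

lemma vzero_vecs [simp]: "vzero \<tau> \<in> vecs \<tau>"
  by (induction \<tau>) auto

lemma vadd_vecs: "a \<in> vecs \<tau> \<Longrightarrow> b \<in> vecs \<tau> \<Longrightarrow> vadd a b \<in> vecs \<tau>"
  by (induction \<tau> arbitrary: a b) fastforce+

lemma vscale_vecs: "a \<in> vecs \<tau> \<Longrightarrow> vscale r a \<in> vecs \<tau>"
  by (induction \<tau> arbitrary: a) fastforce+

lemma semp_vecs:
  "ltyping ar \<Gamma> \<Delta> e \<tau> \<sigma> \<Longrightarrow> \<forall>x\<in>\<Gamma>. \<rho> x \<in> vecs (pty x) \<Longrightarrow> semp den e \<rho> \<in> vecs \<tau>"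
  by (induction arbitrary: \<rho> rule: ltyping.induct) auto

text \<open>The linear map of \<open>e2\<close> in a let is applied to the tangent value of
  \<open>e1\<close>; its specification covers that argument only if the value has the type of the
  bound variable.\<close>

lemma semt_vecs:
  "ltyping ar \<Gamma> \<Delta> e \<tau> \<sigma> \<Longrightarrow> \<forall>x\<in>\<Gamma>. \<rho> x \<in> vecs (pty x) \<Longrightarrow> \<forall>y\<in>\<Delta>. s y \<in> vecs (tty y) \<Longrightarrow>
    semt den e \<rho> s \<in> vecs \<sigma>"
proof (induction arbitrary: \<rho> s rule: ltyping.induct)
  case (ty_Let \<Gamma>1 \<Delta>1 e1 x y \<Gamma>2 \<Delta>2 e2 \<tau> \<sigma>)
  then show ?case
    using semp_vecs[OF ty_Let.hyps(1), of \<rho> den] by simp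
next
  case (ty_LetTPair \<Gamma> x1 x2 \<Delta> e \<tau> \<sigma> z)
  then show ?case
    by fastforce
qed (auto simp: vadd_vecs vscale_vecs)

section \<open>Evaluation of the translation\<close>

text \<open>Since \<open>ys\<close> lists all of \<open>\<Delta>\<close>, every \<open>uvar\<close>
  in a linear map is bound by its pattern; the auxiliary variables are bound by the lets or by the
  pattern, and only primal variables are left.\<close>

lemma fv_delta:
  "ltyping ar \<Gamma> \<Delta> e \<tau> \<sigma> \<Longrightarrow> set ys = \<Delta> \<Longrightarrow> fv (delta e ys) \<subseteq> Prim ` \<Gamma>"
proof (induction arbitrary: ys rule: ltyping.induct)
  case (ty_Let \<Gamma>1 \<Delta>1 e1 x y \<Gamma>2 \<Delta>2 e2 \<tau> \<sigma>)
  have fvt: "fvt e1 = \<Delta>1" "fvt e2 = insert y \<Delta>2"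
    using ty_Let.hyps ltyping_fvt by blast+
  let ?ys1 = "filter (\<lambda>w. w \<in> \<Delta>1) ys" and ?ys2 = "filter (\<lambda>w. w \<in> insert y \<Delta>2 - {y}) ys"
  have "fv (delta e1 ?ys1) \<subseteq> Prim ` \<Gamma>1"
    using ty_Let.prems by (intro ty_Let.IH) auto
  moreover have "fv (delta e2 (y # ?ys2)) \<subseteq> Prim ` insert x \<Gamma>2"
    using ty_Let.prems ty_Let.hyps by (intro ty_Let.IH) auto
  ultimately show ?case
    by (auto simp: Let_def Let_tm_def par_def par_pat_def pvars_u_pat fvt split: if_splits)
next
  case (ty_LetTUnit \<Gamma> \<Delta> e \<tau> \<sigma> z)
  have "fv (delta e (filter (\<lambda>w. w \<noteq> z) ys)) \<subseteq> Prim ` \<Gamma>"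
    using ty_LetTUnit.prems ty_LetTUnit.hyps by (intro ty_LetTUnit.IH) auto
  then show ?case
    by (auto simp: Let_def Let_tm_def par_def par_pat_def pvars_u_pat split: if_splits)
next
  case (ty_LetTPair \<Gamma> x1 x2 \<Delta> e \<tau> \<sigma> z)
  have "fv (delta e (x1 # x2 # filter (\<lambda>w. w \<noteq> z) ys)) \<subseteq> Prim ` \<Gamma>"
    using ty_LetTPair.prems ty_LetTPair.hyps by (intro ty_LetTPair.IH) auto
  \<comment> \<open>The variables \<open>x1\<close> and \<open>x2\<close> are bound by the pattern
    only because \<open>z\<close> occurs in the list and is replaced there by their pair.\<close>
  moreover have "z \<in> set ys"
    using ty_LetTPair.prems by simp
  ultimately show ?case
    by (auto simp: Let_def Let_tm_def par_def par_pat_def pvars_tuple_pat image_iff split: if_splits)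
next
  case (ty_Scale x y)
  then show ?case
    using fv_times_tm[of "tty y" "Prim x"] by (auto simp: par_def pvars_u_pat)
next
  case (ty_Drop \<Gamma> \<Delta> e \<tau> \<sigma>)
  then show ?case
    by (auto simp: Let_def Let_tm_def par_def par_pat_def)
next
  case (ty_Zero \<tau>)
  then show ?case
    by (simp add: par_def flip: enc_t_vzero)
qed (auto simp: par_def pvars_u_pat Let_tm_def)

section \<open>Primal instantiation and the specification of the linear map\<close>

lemma closing_prim_subst [simp]: "closing (prim_subst \<Gamma> \<rho>)"
  by (auto simp: closing_def prim_subst_def split: var.split)

lemma prim_subst_Prim [simp]: "x \<in> \<Gamma> \<Longrightarrow> prim_subst \<Gamma> \<rho> (Prim x) = enc_p (\<rho> x)"
  by (simp add: prim_subst_def)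

lemma prim_subst_other [simp]:
  "prim_subst \<Gamma> \<rho> (Tang y) = Var (Tang y)" "prim_subst \<Gamma> \<rho> (Aux n A) = Var (Aux n A)"
  by (simp_all add: prim_subst_def)

text \<open>Two substitutions that agree on the primal context cannot be told apart by the
  translation. This carries an induction hypothesis over to the substitutions that arise while outer
  lets are evaluated.\<close>

lemma subst_delta:
  assumes "ltyping ar \<Gamma> \<Delta> e \<tau> \<sigma>" "set ys = \<Delta>"
    and "\<And>x. x \<in> \<Gamma> \<Longrightarrow> \<theta> (Prim x) = enc_p (\<rho> x)"
  shows "subst \<theta> (delta e ys) = subst (prim_subst \<Gamma> \<rho>) (delta e ys)"
  using fv_delta[OF assms(1,2)] assms(3) by (intro subst_cong) auto

text \<open>\<open>T\<close> is the tangent semantics with \<open>\<rho>\<close> already fixed. The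
  quantifier over \<open>s\<close> lies inside, so one \<open>F\<close> serves all tangent
  assignments.\<close>

definition computes ::
  "('f \<Rightarrow> nat) \<Rightarrow> ('f \<Rightarrow> real list \<Rightarrow> real) \<Rightarrow> tanvar list \<Rightarrow> ((tanvar \<Rightarrow> vec) \<Rightarrow> vec) \<Rightarrow> 'f tm \<Rightarrow> bool"
where
  "computes ar den ys T F \<longleftrightarrow> is_term F \<and> fv F = {} \<and>
     (\<forall>s. (\<forall>y\<in>set ys. s y \<in> vecs (tty y)) \<longrightarrow>
        reds ar den (App F (tuple (map (\<lambda>y. enc_t (s y)) ys))) (enc_t (T s)))"

text \<open>The last premise ranges over every \<open>\<theta>\<close> with the right values at the
  tangent variables, since matching determines the substitution only there as far as
  \<open>red_beta_u_pat\<close> records.\<close>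

lemma computes_u_pat:
  assumes "distinct ys" "is_term M" "fv M \<subseteq> Tang ` set ys"
    and "\<And>s \<theta>. (\<And>y. y \<in> set ys \<Longrightarrow> s y \<in> vecs (tty y)) \<Longrightarrow>
           (\<And>y. y \<in> set ys \<Longrightarrow> \<theta> (Tang y) = enc_t (s y)) \<Longrightarrow> reds ar den (subst \<theta> M) (enc_t (T s))"
  shows "computes ar den ys T (Lam (u_pat ys) M)"
  unfolding computes_def
proof (intro conjI allI impI)
  fix s :: "tanvar \<Rightarrow> vec"
  assume s: "\<forall>y\<in>set ys. s y \<in> vecs (tty y)"
  obtain \<theta> where "red ar den (App (Lam (u_pat ys) M) (tuple (map (\<lambda>y. enc_t (s y)) ys))) (subst \<theta> M)"
    and "\<And>y. y \<in> set ys \<Longrightarrow> \<theta> (Tang y) = enc_t (s y)"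
    using red_beta_u_pat[OF assms(1)] by blast
  with s assms(4) show "reds ar den (App (Lam (u_pat ys) M) (tuple (map (\<lambda>y. enc_t (s y)) ys))) (enc_t (T s))"
    by (meson converse_rtranclp_into_rtranclp)
qed (use assms(1-3) in \<open>auto simp: linear_u_pat pvars_u_pat\<close>)

lemma computes_const_top:
  assumes "ys = []" "\<And>s. T s = a" "M = enc_t a"
  shows "computes ar den ys T (const_top M)"
  using red_beta[OF binds.intros(1), of ar den _ "enc_t a"] assms by (auto simp: computes_def)

lemma soundI:
  assumes "computes ar den ys T F" "reds ar den M (Tensor (Bang V) (par F))"
  shows "\<exists>F. computes ar den ys T F \<and> reds ar den M (Tensor (Bang V) (par F))"
  using assms by blast

lemma delta_sound:
  assumes "ltyping ar \<Gamma> \<Delta> e \<tau> \<sigma>" and "distinct ys" "set ys = \<Delta>"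
    and "\<forall>x\<in>\<Gamma>. \<rho> x \<in> vecs (pty x)"
  shows "\<exists>F. computes ar den ys (semt den e \<rho>) F \<and>
           reds ar den (subst (prim_subst \<Gamma> \<rho>) (delta e ys))
             (Tensor (Bang (enc_p (semp den e \<rho>))) (par F))"
  using assms
proof (induction arbitrary: ys \<rho> rule: ltyping.induct)
  case (ty_Var x y)
  have "computes ar den ys (semt den (EVar x y) \<rho>) (Lam (u_pat ys) (uvar y))"
    using ty_Var by (intro computes_u_pat) auto
  then show ?case
    by (rule soundI) (use ty_Var in \<open>auto simp: par_def subst_Lam_closing mask_def pvars_u_pat\<close>)
next
  case (ty_Let \<Gamma>1 \<Delta>1 e1 x y \<Gamma>2 \<Delta>2 e2 \<tau> \<sigma>)
  have fvt: "fvt e1 = \<Delta>1" "fvt e2 - {y} = \<Delta>2"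
    using ty_Let.hyps ltyping_fvt by blast+
  let ?ys1 = "filter (\<lambda>w. w \<in> \<Delta>1) ys" and ?ys2 = "filter (\<lambda>w. w \<in> \<Delta>2) ys"
  let ?\<rho> = "\<rho>(x := semp den e1 \<rho>)"
  let ?V1 = "enc_p (semp den e1 \<rho>)" and ?V2 = "enc_p (semp den e2 ?\<rho>)"
  have ys1: "distinct ?ys1" "set ?ys1 = \<Delta>1"
    using ty_Let.prems by auto
  have ys2: "distinct (y # ?ys2)" "set (y # ?ys2) = insert y \<Delta>2"
    using ty_Let.prems ty_Let.hyps by auto
  obtain F1 where F1: "computes ar den ?ys1 (semt den e1 \<rho>) F1"
    "reds ar den (subst (prim_subst \<Gamma>1 \<rho>) (delta e1 ?ys1)) (Tensor (Bang ?V1) (par F1))"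
    using ty_Let.IH(1)[OF ys1] ty_Let.prems(3) by blast
  have \<rho>: "\<forall>v\<in>insert x \<Gamma>2. ?\<rho> v \<in> vecs (pty v)"
    using ty_Let.prems semp_vecs[OF ty_Let.hyps(1)] by simp
  obtain F2 where F2: "computes ar den (y # ?ys2) (semt den e2 ?\<rho>) F2"
    "reds ar den (subst (prim_subst (insert x \<Gamma>2) ?\<rho>) (delta e2 (y # ?ys2)))
       (Tensor (Bang ?V2) (par F2))"
    using ty_Let.IH(2)[OF ys2 \<rho>] by blast
  have cl: "fv F1 = {}" "fv F2 = {}"
    using F1(1) F2(1) by (simp_all add: computes_def)
  let ?f = "Aux ''f'' (lin_ty ?ys1 (tty_exp e1))"
  let ?g = "Aux ''g'' (lin_ty (y # ?ys2) (tty_exp e2))"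
  let ?z = "Aux ''z'' (ty_p (pty_exp e2))"
  let ?body = "\<lambda>F G. Lam (u_pat ys) (App G (tuple (App F (u_tuple ?ys1) # map uvar ?ys2)))"
  let ?T = "Tensor (Bang (Var ?z)) (par (?body (Var ?f) (Var ?g)))"
  let ?L = "Let_tm (PtPair (PtBang ?z) (par_pat (PtVar ?g))) (delta e2 (y # ?ys2)) ?T"
  let ?\<theta>0 = "prim_subst (\<Gamma>1 \<union> \<Gamma>2) \<rho>"
  let ?\<theta>1 = "?\<theta>0(Prim x := ?V1, ?f := F1)"
  let ?\<theta>2 = "?\<theta>1(?z := ?V2, ?g := F2)"
  have eq1: "subst ?\<theta>0 (delta e1 ?ys1) = subst (prim_subst \<Gamma>1 \<rho>) (delta e1 ?ys1)"
    by (rule subst_delta[OF ty_Let.hyps(1)]) (use ty_Let.prems in auto)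
  \<comment> \<open>The name \<open>x\<close> may also belong to \<open>\<Gamma>1\<close>; the
    update at \<open>Prim x\<close> replaces its old value, just as \<open>?\<rho>\<close> shadows
    it.\<close>
  have eq2: "subst ?\<theta>1 (delta e2 (y # ?ys2))
      = subst (prim_subst (insert x \<Gamma>2) ?\<rho>) (delta e2 (y # ?ys2))"
    by (rule subst_delta[OF ty_Let.hyps(2)]) (use ty_Let.prems in auto)
  have "reds ar den (subst ?\<theta>0 (delta (ELet x y e1 e2) ys)) (subst ?\<theta>1 ?L)"
    unfolding delta.simps Let_def fvt using F1(2) cl by (intro reds_let) (simp_all only: eq1, simp_all)
  also have "reds ar den \<dots> (subst ?\<theta>2 ?T)"
    using F2(2) cl by (intro reds_let) (simp_all only: eq2, simp_all)
  \<comment> \<open>The binder holds only tangent variables or the spare variable \<open>u\<close>,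
    so \<open>f\<close> and \<open>g\<close> are replaced beneath it while the \<open>uvar\<close>s
    stay.\<close>
  also have "subst ?\<theta>2 ?T = Tensor (Bang ?V2) (par (?body F1 F2))"
    using cl by (simp add: par_def subst_Lam_closing mask_def pvars_u_pat image_iff o_def cong: if_cong)
  finally have red: "reds ar den (subst ?\<theta>0 (delta (ELet x y e1 e2) ys)) \<dots>" .
  have "computes ar den ys (semt den (ELet x y e1 e2) \<rho>) (?body F1 F2)"
  proof (rule computes_u_pat)
    fix s and \<theta> :: "var \<Rightarrow> 'a tm"
    assume s: "\<And>w. w \<in> set ys \<Longrightarrow> s w \<in> vecs (tty w)"
      and \<theta>: "\<And>w. w \<in> set ys \<Longrightarrow> \<theta> (Tang w) = enc_t (s w)"
    let ?b = "semt den e1 \<rho> s"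
    let ?s = "s(y := ?b)"
    have b: "?b \<in> vecs (tty y)"
      using ty_Let.hyps(1) ty_Let.prems s by (auto intro!: semt_vecs)
    \<comment> \<open>Passing from \<open>s\<close> to \<open>?s\<close> on \<open>?ys2\<close> is
      harmless because \<open>y\<close> is not in \<open>\<Delta>2\<close>. The argument of
      \<open>F1\<close> keeps \<open>s\<close>, as \<open>y\<close> may be a free variable of
      \<open>e1\<close>.\<close>
    have "subst \<theta> (App F2 (tuple (App F1 (u_tuple ?ys1) # map uvar ?ys2)))
        = App F2 (tuple (App F1 (tuple (map (\<lambda>w. enc_t (s w)) ?ys1)) # map (\<lambda>w. enc_t (?s w)) ?ys2))"
      using \<theta> cl ty_Let.hyps by (auto intro!: arg_cong[of _ _ tuple])
    also have "reds ar den \<dots> (App F2 (tuple (enc_t ?b # map (\<lambda>w. enc_t (?s w)) ?ys2)))"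
      using F1(1) s by (intro reds_App2 reds_tuple_hd) (auto simp: computes_def)
    also have "\<dots> = App F2 (tuple (map (\<lambda>w. enc_t (?s w)) (y # ?ys2)))"
      by simp
    also have "reds ar den \<dots> (enc_t (semt den e2 ?\<rho> ?s))"
    proof -
      have "\<forall>w\<in>set (y # ?ys2). ?s w \<in> vecs (tty w)"
        using s b by auto
      then show ?thesis
        using F2(1) unfolding computes_def by blast
    qed
    finally show "reds ar den (subst \<theta> (App F2 (tuple (App F1 (u_tuple ?ys1) # map uvar ?ys2))))
        (enc_t (semt den (ELet x y e1 e2) \<rho> s))"
      by simp
  qed (use F1(1) F2(1) ty_Let.prems in \<open>auto simp: computes_def\<close>)
  then show ?case
    by (rule soundI) (use red in \<open>simp only: semp.simps enc_p.simps\<close>)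
next
  case (ty_LetPUnit \<Gamma> \<Delta> e \<tau> \<sigma> z)
  obtain F where F: "computes ar den ys (semt den e \<rho>) F"
    "reds ar den (subst (prim_subst \<Gamma> \<rho>) (delta e ys)) (Tensor (Bang (enc_p (semp den e \<rho>))) (par F))"
    using ty_LetPUnit.IH[OF ty_LetPUnit.prems(1,2)] ty_LetPUnit.prems(3) by blast
  let ?\<theta> = "prim_subst (insert z \<Gamma>) \<rho>"
  \<comment> \<open>A primal variable of unit type is instantiated by \<open>Unit\<close>, which is
    already a value for the pattern.\<close>
  have "\<rho> z = VStar"
    using ty_LetPUnit by auto
  then have "subst ?\<theta> (delta (ELetPUnit z e) ys) = App (subst ?\<theta> (Lam PtUnit (delta e ys))) Unit"
    by (simp add: Let_tm_def)
  also have "red ar den \<dots> (subst (\<lambda>y. if y \<in> pvars PtUnit then Var y else ?\<theta> y) (delta e ys))"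
    by (intro red_beta_closed binds.intros) auto
  also have "subst (\<lambda>y. if y \<in> pvars PtUnit then Var y else ?\<theta> y) (delta e ys)
      = subst (prim_subst \<Gamma> \<rho>) (delta e ys)"
    by (rule subst_delta[OF ty_LetPUnit.hyps(1)]) (use ty_LetPUnit.prems in auto)
  also note F(2)
  finally have red: "reds ar den (subst ?\<theta> (delta (ELetPUnit z e) ys))
      (Tensor (Bang (enc_p (semp den e \<rho>))) (par F))" .
  have "computes ar den ys (semt den (ELetPUnit z e) \<rho>) F"
    using F(1) by (simp add: computes_def)
  then show ?case
    by (rule soundI) (use red in \<open>simp only: semp.simps\<close>)
next
  case (ty_LetTUnit \<Gamma> \<Delta> e \<tau> \<sigma> z)
  let ?ys = "filter (\<lambda>w. w \<noteq> z) ys" and ?V = "enc_p (semp den e \<rho>)"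
  have ys: "distinct ?ys" "set ?ys = \<Delta>"
    using ty_LetTUnit.prems ty_LetTUnit.hyps by auto
  obtain F where F: "computes ar den ?ys (semt den e \<rho>) F"
    "reds ar den (subst (prim_subst \<Gamma> \<rho>) (delta e ?ys)) (Tensor (Bang ?V) (par F))"
    using ty_LetTUnit.IH[OF ys ty_LetTUnit.prems(3)] by blast
  have cl: "fv F = {}"
    using F(1) by (simp add: computes_def)
  let ?f = "Aux ''f'' (lin_ty ?ys (tty_exp e))" and ?x = "Aux ''x'' (ty_p (pty_exp e))"
  let ?body = "\<lambda>F. Lam (u_pat ys) (App F (u_tuple ?ys))"
  have "reds ar den (subst (prim_subst \<Gamma> \<rho>) (delta (ELetTUnit z e) ys))
     (subst ((prim_subst \<Gamma> \<rho>)(?x := ?V, ?f := F)) (Tensor (Bang (Var ?x)) (par (?body (Var ?f)))))"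
    unfolding delta.simps Let_def using F(2) cl by (intro reds_let) auto
  also have "\<dots> = Tensor (Bang ?V) (par (?body F))"
    using cl by (simp add: par_def subst_Lam_closing mask_def pvars_u_pat image_iff o_def cong: if_cong)
  finally have red: "reds ar den (subst (prim_subst \<Gamma> \<rho>) (delta (ELetTUnit z e) ys)) \<dots>" .
  have "computes ar den ys (semt den (ELetTUnit z e) \<rho>) (?body F)"
  proof (rule computes_u_pat)
    fix s and \<theta> :: "var \<Rightarrow> 'a tm"
    assume s: "\<And>w. w \<in> set ys \<Longrightarrow> s w \<in> vecs (tty w)"
      and \<theta>: "\<And>w. w \<in> set ys \<Longrightarrow> \<theta> (Tang w) = enc_t (s w)"
    have "subst \<theta> (App F (u_tuple ?ys)) = App F (tuple (map (\<lambda>w. enc_t (s w)) ?ys))"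
      using \<theta> cl by (auto intro!: arg_cong[of _ _ tuple])
    also have "reds ar den \<dots> (enc_t (semt den e \<rho> s))"
      using F(1) s by (auto simp: computes_def)
    finally show "reds ar den (subst \<theta> (App F (u_tuple ?ys))) (enc_t (semt den (ELetTUnit z e) \<rho> s))"
      by simp
  qed (use F(1) ty_LetTUnit.prems in \<open>auto simp: computes_def\<close>)
  then show ?case
    by (rule soundI) (use red in \<open>simp only: semp.simps enc_p.simps\<close>)
next
  case (ty_TPair x1 x2)
  have "computes ar den ys (semt den (ETPair x1 x2) \<rho>) (Lam (u_pat ys) (With (uvar x1) (uvar x2)))"
    using ty_TPair by (intro computes_u_pat) auto
  then show ?case
    by (rule soundI) (use ty_TPair in \<open>auto simp: par_def subst_Lam_closing mask_def pvars_u_pat\<close>)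
next
  case (ty_LetTPair \<Gamma> y1 y2 \<Delta> e \<tau> \<sigma> z)
  let ?ys' = "filter (\<lambda>w. w \<noteq> z) ys" and ?V = "enc_p (semp den e \<rho>)"
  let ?ys = "y1 # y2 # ?ys'"
  have ys: "distinct ?ys" "set ?ys = insert y1 (insert y2 \<Delta>)"
    using ty_LetTPair.prems ty_LetTPair.hyps by auto
  obtain F where F: "computes ar den ?ys (semt den e \<rho>) F"
    "reds ar den (subst (prim_subst \<Gamma> \<rho>) (delta e ?ys)) (Tensor (Bang ?V) (par F))"
    using ty_LetTPair.IH[OF ys ty_LetTPair.prems(3)] by blast
  have cl: "fv F = {}"
    using F(1) by (simp add: computes_def)
  have z: "z \<in> set ys"
    using ty_LetTPair.prems by simp
  let ?f = "Aux ''f'' (lin_ty ?ys (tty_exp e))" and ?x = "Aux ''x'' (ty_p (pty_exp e))"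
  let ?x1 = "Aux ''x1'' (ty_t (tty y1))" and ?x2 = "Aux ''x2'' (ty_t (tty y2))"
  let ?P = "\<lambda>w. if w = z then PtWith (PtVar ?x1) (PtVar ?x2) else PtVar (Tang w)"
  let ?A = "\<lambda>F. App F (tuple (Var ?x1 # Var ?x2 # map uvar ?ys'))"
  let ?body = "\<lambda>F. Lam (tuple_pat (map ?P ys)) (?A F)"
  \<comment> \<open>Because \<open>z\<close> is in \<open>ys\<close>, the list is nonempty and
    \<open>?x1\<close>, \<open>?x2\<close> do occur in the pattern.\<close>
  have pv: "pvars (tuple_pat (map ?P ys)) = {?x1, ?x2} \<union> Tang ` set ?ys'"
    using z by (auto simp: pvars_tuple_pat split: if_splits)
  have "reds ar den (subst (prim_subst \<Gamma> \<rho>) (delta (ELetTPair y1 y2 z e) ys))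
     (subst ((prim_subst \<Gamma> \<rho>)(?x := ?V, ?f := F)) (Tensor (Bang (Var ?x)) (par (?body (Var ?f)))))"
    unfolding delta.simps Let_def using F(2) cl by (intro reds_let) auto
  also have "\<dots> = Tensor (Bang ?V) (par (?body F))"
    using cl by (simp add: par_def subst_Lam_closing mask_def pv image_iff o_def cong: if_cong del: tuple.simps)
  finally have red: "reds ar den (subst (prim_subst \<Gamma> \<rho>) (delta (ELetTPair y1 y2 z e) ys)) \<dots>" .
  have "computes ar den ys (semt den (ELetTPair y1 y2 z e) \<rho>) (?body F)"
    unfolding computes_def
  proof (intro conjI allI impI)
    have "linear_pat (tuple_pat (map ?P ys))"
      using ty_LetTPair.prems(1) by (intro linear_tuple_pat) auto
    then show "is_term (?body F)"
      using F(1) by (auto simp: computes_def simp del: tuple.simps)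
    show "fv (?body F) = {}"
      using cl by (auto simp: pv simp del: tuple.simps)
  next
    fix s :: "tanvar \<Rightarrow> vec"
    assume s: "\<forall>w\<in>set ys. s w \<in> vecs (tty w)"
    \<comment> \<open>The type of \<open>z\<close> forces \<open>s z\<close> to be a pair, so its
      encoding is a value for the nested pair pattern.\<close>
    then have "s z \<in> vecs (LTensor (tty y1) (tty y2))"
      using z ty_LetTPair.hyps by metis
    then obtain a b where sz: "s z = VPair a b" and ab: "a \<in> vecs (tty y1)" "b \<in> vecs (tty y2)"
      by auto
    let ?s = "s(y1 := a, y2 := b)"
    let ?\<eta> = "\<lambda>w. if w = z
        then (\<lambda>v. if v \<in> pvars (PtVar ?x1) then (Var(?x1 := enc_t a)) v else (Var(?x2 := enc_t b)) v)
        else Var(Tang w := enc_t (s w)) :: var \<Rightarrow> 'a tm"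
    have binds: "binds (?P w) (enc_t (s w)) (?\<eta> w)" for w
    proof (cases "w = z")
      case True
      have "binds (PtWith (PtVar ?x1) (PtVar ?x2)) (With (enc_t a) (enc_t b)) (?\<eta> z)"
        unfolding if_P[OF refl] by (intro binds.intros)
      then show ?thesis
        using sz True by simp
    next
      case False
      then show ?thesis
        by (simp add: binds.intros)
    qed
    have "\<exists>\<theta>. binds (tuple_pat (map ?P ys)) (tuple (map (\<lambda>w. enc_t (s w)) ys)) \<theta> \<and>
        (\<forall>w\<in>set ys. \<forall>v\<in>pvars (?P w). \<theta> v = ?\<eta> w v)"
    proof (rule binds_tuple_pat[OF ty_LetTPair.prems(1)])
      show "binds (?P w) (enc_t (s w)) (?\<eta> w)" for w
        by (rule binds)
      show "pvars (?P w) \<inter> pvars (?P w') = {}" if "w \<noteq> w'" for w w'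
        using that by auto
    qed
    then obtain \<theta> where \<theta>b: "binds (tuple_pat (map ?P ys)) (tuple (map (\<lambda>w. enc_t (s w)) ys)) \<theta>"
      and \<theta>: "\<forall>w\<in>set ys. \<forall>v\<in>pvars (?P w). \<theta> v = ?\<eta> w v"
      by (elim exE conjE) (rule that)
    have \<theta>x: "\<theta> ?x1 = enc_t a" "\<theta> ?x2 = enc_t b"
      using bspec[OF \<theta> z] by simp_all
    have \<theta>u: "\<theta> (Tang w) = enc_t (s w)" if "w \<in> set ?ys'" for w
      using bspec[OF \<theta>, of w] that by simp
    \<comment> \<open>The updates at \<open>y1\<close> and \<open>y2\<close> thus leave the
      remaining components unchanged and do not overwrite each other, even if one of the two names
      is \<open>z\<close>.\<close>
    have "y1 \<notin> set ?ys'" "y2 \<notin> set ?ys'" "y1 \<noteq> y2"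
      using ty_LetTPair by auto
    then have "map (subst \<theta>) (Var ?x1 # Var ?x2 # map uvar ?ys') = map (\<lambda>w. enc_t (?s w)) ?ys"
      using \<theta>x \<theta>u by auto
    then have eq: "subst \<theta> (?A F) = App F (tuple (map (\<lambda>w. enc_t (?s w)) ?ys))"
      using cl by (simp only: subst.simps subst_tuple subst_closed)
    have "\<forall>w\<in>set ?ys. ?s w \<in> vecs (tty w)"
      using s ab by auto
    then have "reds ar den (App F (tuple (map (\<lambda>w. enc_t (?s w)) ?ys))) (enc_t (semt den e \<rho> ?s))"
      using F(1) unfolding computes_def by blast
    with red_beta[OF \<theta>b, of ar den "?A F"]
    have "reds ar den (App (?body F) (tuple (map (\<lambda>w. enc_t (s w)) ys))) (enc_t (semt den e \<rho> ?s))"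
      unfolding eq by (rule converse_rtranclp_into_rtranclp)
    then show "reds ar den (App (?body F) (tuple (map (\<lambda>w. enc_t (s w)) ys)))
        (enc_t (semt den (ELetTPair y1 y2 z e) \<rho> s))"
      by (simp only: semt.simps sz vec.sel)
  qed
  then show ?case
    by (rule soundI) (use red in \<open>simp only: semp.simps enc_p.simps\<close>)
next
  case (ty_Zero \<tau>)
  show ?case
    by (rule soundI[OF computes_const_top[where a = "vzero \<tau>"]])
      (use ty_Zero in \<open>auto simp: par_def subst_Lam_closing simp flip: enc_t_vzero\<close>)
next
  case (ty_Add x y \<tau>)
  have "computes ar den ys (semt den (EAdd x y) \<rho>)
      (Lam (u_pat ys) (App (plus_tm (ty_t \<tau>)) (With (uvar x) (uvar y))))"
  proof (rule computes_u_pat)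
    fix s and \<theta> :: "var \<Rightarrow> 'a tm"
    assume s: "\<And>w. w \<in> set ys \<Longrightarrow> s w \<in> vecs (tty w)"
      and \<theta>: "\<And>w. w \<in> set ys \<Longrightarrow> \<theta> (Tang w) = enc_t (s w)"
    have "s x \<in> vecs \<tau>" "s y \<in> vecs \<tau>"
      using s[of x] s[of y] ty_Add by simp_all
    then show "reds ar den (subst \<theta> (App (plus_tm (ty_t \<tau>)) (With (uvar x) (uvar y))))
        (enc_t (semt den (EAdd x y) \<rho> s))"
      using \<theta> ty_Add.prems by (simp add: reds_plus_tm)
  qed (use ty_Add in \<open>auto simp: is_term_plus_tm\<close>)
  then show ?case
    by (rule soundI) (use ty_Add in \<open>auto simp: par_def subst_Lam_closing mask_def pvars_u_pat\<close>)
next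
  case (ty_Scale x y)
  obtain r where r: "\<rho> x = VReal r"
    using ty_Scale by auto
  \<comment> \<open>The linear map depends on \<open>\<rho>\<close> here: the scalar has been
    substituted into \<open>times_tm\<close>, and the pattern, which binds only
    \<open>Tang y\<close>, does not mask it.\<close>
  let ?M = "subst (mask (pvars (u_pat ys)) (prim_subst {x} \<rho>)) (times_tm (ty_t (tty y)) (Prim x)) :: 'a tm"
  have ys: "pvars (u_pat ys) = {Tang y}"
    using ty_Scale.prems by (auto simp: pvars_u_pat)
  have cl: "fv ?M = {}" "is_term ?M"
    by (intro fv_subst_times_tm is_term_subst_times_tm; simp add: mask_def ys)+
  have "computes ar den ys (semt den (EScale x y) \<rho>) (Lam (u_pat ys) (App ?M (uvar y)))"
  proof (rule computes_u_pat)
    fix s and \<theta> :: "var \<Rightarrow> 'a tm"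
    assume s: "\<And>w. w \<in> set ys \<Longrightarrow> s w \<in> vecs (tty w)"
      and \<theta>: "\<And>w. w \<in> set ys \<Longrightarrow> \<theta> (Tang w) = enc_t (s w)"
    have "reds ar den (App ?M (enc_t (s y))) (enc_t (vscale r (s y)))"
      by (rule reds_times_tm) (use s ty_Scale.prems r in \<open>auto simp: mask_def ys\<close>)
    then show "reds ar den (subst \<theta> (App ?M (uvar y))) (enc_t (semt den (EScale x y) \<rho> s))"
      using \<theta> ty_Scale.prems cl r by simp
  qed (use cl ty_Scale.prems in auto)
  then show ?case
    by (rule soundI) (simp add: par_def subst_Lam_closing mask_def ys)
next
  case (ty_Fun xs f)
  have \<rho>: "enc_p (\<rho> x) = (Num (vreal (\<rho> x)) :: 'a tm)" if "x \<in> set xs" for x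
    using that ty_Fun by force
  let ?rs = "map (\<lambda>x. vreal (\<rho> x)) xs"
  let ?\<theta> = "prim_subst (set xs) \<rho> :: var \<Rightarrow> 'a tm"
  have "subst ?\<theta> (delta (EFun f xs) ys)
      = Tensor (App (Fun f) (pairs (map (\<lambda>r. Bang (Num r)) ?rs))) (par (const_top Top))"
    using \<rho> by (simp add: par_def o_def cong: map_cong)
  also have "red ar den \<dots> (Tensor (Bang (Num (den f ?rs))) (par (const_top Top)))"
    using ty_Fun by (intro red_Pair1 red_fun) auto
  finally have red: "reds ar den (subst ?\<theta> (delta (EFun f xs) ys))
      (Tensor (Bang (enc_p (semp den (EFun f xs) \<rho>))) (par (const_top Top)))"
    by auto
  show ?case
    by (rule soundI[OF computes_const_top[where a = VStar] red]) (use ty_Fun in auto)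
next
  case (ty_Dup y)
  have "computes ar den ys (semt den (EDup y) \<rho>) (Lam (u_pat ys) (With (uvar y) (uvar y)))"
    using ty_Dup by (intro computes_u_pat) auto
  then show ?case
    by (rule soundI) (use ty_Dup in \<open>auto simp: par_def subst_Lam_closing mask_def pvars_u_pat\<close>)
next
  case (ty_Drop \<Gamma> \<Delta> e \<tau> \<sigma>)
  let ?V = "enc_p (semp den e \<rho>)"
  obtain F where F: "computes ar den ys (semt den e \<rho>) F"
    "reds ar den (subst (prim_subst \<Gamma> \<rho>) (delta e ys)) (Tensor (Bang ?V) (par F))"
    using ty_Drop.IH[OF ty_Drop.prems] by blast
  have cl: "fv F = {}"
    using F(1) by (simp add: computes_def)
  let ?f = "Aux ''f'' (lin_ty ys (tty_exp e))" and ?x = "Aux ''x'' (ty_p (pty_exp e))"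
  let ?y = "Aux ''y'' (with_ty (map (\<lambda>y. ty_t (tty y)) ys))" and ?z = "Aux ''z'' (ty_t (tty_exp e))"
  let ?body = "\<lambda>F. Lam (PtVar ?y) (Let_tm (PtVar ?z) (App F (Var ?y)) Top)"
  have "reds ar den (subst (prim_subst \<Gamma> \<rho>) (delta (EDrop e) ys))
     (subst ((prim_subst \<Gamma> \<rho>)(?x := ?V, ?f := F)) (Tensor (Bang Unit) (par (?body (Var ?f)))))"
    unfolding delta.simps Let_def using F(2) cl by (intro reds_let) auto
  also have "\<dots> = Tensor (Bang Unit) (par (?body F))"
    using cl by (simp add: par_def Let_tm_def subst_Lam_closing mask_def)
  finally have red: "reds ar den (subst (prim_subst \<Gamma> \<rho>) (delta (EDrop e) ys)) \<dots>" .
  \<comment> \<open>Any term is a value for a variable pattern, so \<open>App F N\<close> is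
    discarded unevaluated and nothing is asked of \<open>N\<close>. As \<open>N\<close> may be open,
    the inner abstraction is handled by its own closedness.\<close>
  have "reds ar den (App (?body F) N) Top" for N
  proof -
    have "red ar den (App (?body F) N) (subst (Var(?y := N)) (Let_tm (PtVar ?z) (App F (Var ?y)) Top))"
      by (intro red_beta binds.intros)
    also have "\<dots> = App (subst (Var(?y := N)) (Lam (PtVar ?z) Top)) (App F N)"
      using cl by (simp add: Let_tm_def)
    also have "\<dots> = App (Lam (PtVar ?z) Top) (App F N)"
      by simp
    also have "red ar den \<dots> (subst (Var(?z := App F N)) Top)"
      by (intro red_beta binds.intros)
    finally show ?thesis
      by simp
  qed
  then have "computes ar den ys (semt den (EDrop e) \<rho>) (?body F)"
    using F(1) by (auto simp: computes_def Let_tm_def)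
  then show ?case
    by (rule soundI) (use red in \<open>simp only: semp.simps enc_p.simps\<close>)
\<comment> \<open>The cases left are the two units and the constants, all with empty tangent context
  and tangent value \<open>VStar\<close>.\<close>
qed (rule soundI[OF computes_const_top[where a = VStar and M = Top]];
  simp add: par_def subst_Lam_closing)+

theorem proposition3:
  fixes ar :: "'f \<Rightarrow> nat" and den :: "'f \<Rightarrow> real list \<Rightarrow> real"
    and e :: "'f exp" and \<Gamma> :: "primvar set" and \<Sigma> :: "tanvar set" and \<tau> \<sigma> :: lty
    and \<theta> :: "tanvar list" and \<rho> :: "primvar \<Rightarrow> vec"
  assumes arity: "\<And>f. 1 \<le> ar f"
    and diff: "\<And>f. differentiable_Rn (ar f) (den f)"
    and typing: "ltyping ar \<Gamma> \<Sigma> e \<tau> \<sigma>"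
    and enum: "distinct \<theta>" "set \<theta> = \<Sigma>"
    and assignment: "\<forall>x\<in>\<Gamma>. \<rho> x \<in> vecs (pty x)"
  shows "\<exists>F :: 'f tm. is_term F \<and>
           reds ar den (subst (prim_subst \<Gamma> \<rho>) (delta e \<theta>))
             (Tensor (Bang (enc_p (semp den e \<rho>))) (par F)) \<and>
           (\<forall>s. (\<forall>y\<in>\<Sigma>. s y \<in> vecs (tty y)) \<longrightarrow>
              reds ar den (App F (tuple (map (\<lambda>y. enc_t (s y)) \<theta>)))
                (enc_t (semt den e \<rho> s)))"
proof -
  from delta_sound[OF typing enum assignment, of den] show ?thesis
    unfolding computes_def enum(2) by blast
qed

end
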